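(* Let $M,N\geq1$ be integers, $\Gamma=\mathbb Z/M\mathbb Z\times\mathbb Z/N\mathbb Z$, let $\gamma=(\bar u,\bar v)\in\Gamma\setminus\{(\bar0,\bar0)\}$ with integer representatives $u,v$, let $\tau$ be in the upper half-plane and put $\tilde\gamma=\frac uM+\frac vN\tau$. Define $$F_\gamma(x|\tau):=e^{\frac{2\pi\mathrm iv}Nx}\,\frac{\theta(\tilde\gamma+x|\tau)}{\theta(\tilde\gamma|\tau)\,\theta(x|\tau)},$$ $$a_{1,\gamma}(\tau):=\frac{2\pi\mathrm iv}N+\frac{\partial_x\theta(\tilde\gamma|\tau)}{\theta(\tilde\gamma|\tau)},\qquad a_{s,\gamma}(\tau):=(-1)^s\,\frac{G_s(\tau)-G_{s,\gamma}(\tau)}s\quad(s\ge2).$$ Then, as Laurent expansions at $x=0$, $$F_\gamma(x|\tau)=\frac1x\exp\Big(\sum_{s\ge1}a_{s,\gamma}(\tau)x^s\Big).$$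
   Context: $\theta(z|\tau)$ is the theta function, holomorphic on $\mathbb{C}\times\mathfrak h$ ($\mathfrak h$ the upper half-plane), with $\theta(z+1|\tau)=-\theta(z|\tau)=\theta(-z|\tau)$, $\theta(z+\tau|\tau)=-e^{-\pi\mathrm i\tau}e^{-2\pi\mathrm iz}\theta(z|\tau)$, $\partial_z\theta(0|\tau)=1$, and zero set $\Lambda_\tau=\mathbb Z+\tau\mathbb Z$ in $z$; $\partial_x\theta$ is the derivative in the first variable. For $s\ge2$ and $z\notin\Lambda_\tau$, $$G_s(z|\tau)=\sum_{n=-\infty}^{+\infty}\Big(\sum_{m=-\infty}^{+\infty}\frac1{(m+n\tau+z)^s}\Big),\qquad G_s(\tau)=\sum_{n=-\infty}^{+\infty}\Big(\sum_{\substack{m=-\infty\\ m\ne0\text{ if }n=0}}^{+\infty}\frac1{(m+n\tau)^s}\Big)$$ (summed in this order for $s=2$), and $G_{s,\gamma}(\tau):=G_s(\tilde\gamma|\tau)$ for $\gamma\ne(\bar0,\bar0)$. *)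

theory Defs
  imports
    "HOL-Complex_Analysis.Complex_Analysis"
    "HOL-Number_Theory.Cong"
begin

definition period_lattice :: "complex \<Rightarrow> complex set" where
  "period_lattice \<tau> = {of_int m + of_int n * \<tau> | m n. True}"

(* Holomorphy in two complex variables: total differentiability with a
   complex-linear derivative. *)
definition holomorphic2_on ::
  "(complex \<Rightarrow> complex \<Rightarrow> complex) \<Rightarrow> (complex \<times> complex) set \<Rightarrow> bool" where
  "holomorphic2_on f S \<longleftrightarrow>
     (\<forall>p\<in>S. \<exists>a b. ((\<lambda>(z, \<tau>). f z \<tau>) has_derivative (\<lambda>(h, k). a * h + b * k)) (at p within S))"

(* These properties determine \<theta> z \<tau> for all z and all \<tau> in the upper half-plane: by the
   normalisation and the quasi-periodicity all zeros are simple, so the quotient of two such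
   functions is, for fixed \<tau>, elliptic and entire, hence constant, and equal to 1.
   Nothing is required of \<theta> z \<tau> when Im \<tau> \<le> 0. *)
definition theta_function :: "(complex \<Rightarrow> complex \<Rightarrow> complex) \<Rightarrow> bool" where
  "theta_function \<theta> \<longleftrightarrow>
     holomorphic2_on \<theta> (UNIV \<times> {\<tau>. Im \<tau> > 0}) \<and>
     (\<forall>z \<tau>. Im \<tau> > 0 \<longrightarrow>
        \<theta> (z + 1) \<tau> = - \<theta> z \<tau> \<and>
        \<theta> (- z) \<tau> = - \<theta> z \<tau> \<and>
        \<theta> (z + \<tau>) \<tau> = - exp (- (of_real pi * \<i> * \<tau>)) * exp (- (2 * of_real pi * \<i> * z)) * \<theta> z \<tau>) \<and>
     (\<forall>\<tau>. Im \<tau> > 0 \<longrightarrow>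
        deriv (\<lambda>z. \<theta> z \<tau>) 0 = 1 \<and>
        {z. \<theta> z \<tau> = 0} = period_lattice \<tau>)"

(* For s \<ge> 2, Im \<tau> > 0 and z off the lattice, the inner sums converge absolutely, and so does
   the outer sum of their values (for s = 2 since the n-th inner sum is
   pi^2 / sin (pi * (z + n * \<tau>))^2). Hence infsum agrees with the bilateral series; for s = 2
   the double family is not absolutely summable, and the order of summation matters. *)
definition eisenstein_at :: "nat \<Rightarrow> complex \<Rightarrow> complex \<Rightarrow> complex" where
  "eisenstein_at s z \<tau> =
     (\<Sum>\<^sub>\<infinity>n::int. \<Sum>\<^sub>\<infinity>m::int. 1 / (of_int m + of_int n * \<tau> + z) ^ s)"

definition eisenstein :: "nat \<Rightarrow> complex \<Rightarrow> complex" where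
  "eisenstein s \<tau> =
     (\<Sum>\<^sub>\<infinity>n::int. \<Sum>\<^sub>\<infinity>m\<in>{m::int. n = 0 \<longrightarrow> m \<noteq> 0}. 1 / (of_int m + of_int n * \<tau>) ^ s)"

definition torsion_point :: "int \<Rightarrow> int \<Rightarrow> int \<Rightarrow> int \<Rightarrow> complex \<Rightarrow> complex" where
  "torsion_point M N u v \<tau> = of_int u / of_int M + of_int v / of_int N * \<tau>"

definition F_gamma ::
  "(complex \<Rightarrow> complex \<Rightarrow> complex) \<Rightarrow> int \<Rightarrow> int \<Rightarrow> int \<Rightarrow> int \<Rightarrow> complex \<Rightarrow> complex \<Rightarrow> complex" where
  "F_gamma \<theta> M N u v x \<tau> =
     exp (2 * of_real pi * \<i> * of_int v / of_int N * x) *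
     (\<theta> (torsion_point M N u v \<tau> + x) \<tau> / (\<theta> (torsion_point M N u v \<tau>) \<tau> * \<theta> x \<tau>))"

(* The value at s = 0 is a dummy: the exponent sums over s \<ge> 1, so its formal power series
   has constant coefficient 0. *)
definition a_gamma ::
  "(complex \<Rightarrow> complex \<Rightarrow> complex) \<Rightarrow> int \<Rightarrow> int \<Rightarrow> int \<Rightarrow> int \<Rightarrow> complex \<Rightarrow> nat \<Rightarrow> complex" where
  "a_gamma \<theta> M N u v \<tau> s =
     (if s = 0 then 0
      else if s = 1 then
        2 * of_real pi * \<i> * of_int v / of_int N +
        deriv (\<lambda>x. \<theta> x \<tau>) (torsion_point M N u v \<tau>) / \<theta> (torsion_point M N u v \<tau>) \<tau>
      else
        (- 1) ^ s * (eisenstein s \<tau> - eisenstein_at s (torsion_point M N u v \<tau>) \<tau>) / of_nat s)"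

end

theory Submission
  imports Defs
begin

text \<open>
  Write F for the quotient in question and L for the logarithmic derivative of theta in its first
  variable. Since theta has a simple zero with derivative 1 at the origin, x F(x) is regular at 0
  with value 1 there, so F(x) = exp (a(x)) / x where a(0) = 0 and
  a'(x) = 2 \<pi> \<i> v / N + L(\<gamma> + x) - (L(x) - 1 / x).
  It remains to compute the Taylor coefficients of a'. The constant one is immediate because theta
  is odd, so that L(x) - 1 / x vanishes at 0. All others follow from the single identity
  L'(z) = - G2(z), where G2 denotes the Eisenstein sum of weight 2: term-by-term differentiation
  turns G2 into the sums of higher weight, evaluated at \<gamma> and, with the term at the origin
  removed, at 0.

  To prove L' = - G2, consider L' + G2. Quasi-periodicity makes it doubly periodic, its double
  poles cancel, and so it is constant by Liouville's theorem (lemma defect_constant). The integral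
  over a segment from p to p + 1 is zero: L has period 1, and row n of G2, which is equal to
  \<pi>^2 / sin(\<pi> (z + n \<tau>))^2, has the primitive - \<pi> cot(\<pi> (z + n \<tau>)), also of period 1. So the
  constant is zero (lemma defect_eq_0). This is the step in which the conditionally
  convergent sum has to be taken in the prescribed order.

  The analytic input is the convergence of the outer sum in weight 2. It rests on the closed form of
  the rows (lemma has_sum_inverse_square_complex), obtained from the reflection formula for the Gamma
  function, and the resulting bound 4 / (Im w)^2. Convergence in the higher weights, and
  term-by-term differentiation, then come from Weierstrass' theorem on locally uniform limits of
  holomorphic functions (lemma infsum_int_holomorphic).
\<close>

section \<open>Sums over the integers of holomorphic functions\<close>

lemma summable_on_inverse_square_int: "(\<lambda>n::int. 1 / (of_int n :: real)^2) summable_on UNIV"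
proof -
  have nat: "(\<lambda>n::nat. 1 / (of_nat n :: real)^2) summable_on UNIV"
    using inverse_power_summable[of 2, where 'a = real]
    by (intro summable_nonneg_imp_summable_on) (auto simp: field_simps)
  have "(\<lambda>n::int. 1 / (of_int n :: real)^2) summable_on range int"
    by (subst summable_on_reindex) (use nat in \<open>auto simp: o_def\<close>)
  moreover have "(\<lambda>n::int. 1 / (of_int n :: real)^2) summable_on range (\<lambda>n. - int n)"
    by (subst summable_on_reindex) (use nat in \<open>auto simp: o_def inj_on_def\<close>)
  ultimately have "(\<lambda>n::int. 1 / (of_int n :: real)^2) summable_on (range int \<union> range (\<lambda>n. - int n))"
    by (rule summable_on_union)
  also have "range int \<union> range (\<lambda>n. - int n) = UNIV"
  proof -
    have "n \<in> range int \<union> range (\<lambda>n. - int n)" for n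
      by (cases n rule: int_cases2) auto
    thus ?thesis by blast
  qed
  finally show ?thesis .
qed

text \<open>
  The Weierstrass test in the form in which it meets lattice sums: a quadratic bound holds only for
  large |n|, and the finitely many other terms, which may be arbitrarily large near a pole, are
  bounded on K by compactness.
\<close>

lemma uniform_limit_infsum_int:
  fixes f :: "int \<Rightarrow> 'a::topological_space \<Rightarrow> complex"
  assumes "compact K" "\<And>n. n \<in> I \<Longrightarrow> continuous_on K (f n)"
    and bound: "\<And>n z. n \<in> I \<Longrightarrow> k \<le> \<bar>n\<bar> \<Longrightarrow> z \<in> K \<Longrightarrow> norm (f n z) \<le> c / of_int n ^ 2"
  shows "uniform_limit K (\<lambda>A z. \<Sum>n\<in>A. f n z) (\<lambda>z. \<Sum>\<^sub>\<infinity>n\<in>I. f n z) (finite_subsets_at_top I)"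
proof -
  have "\<exists>B\<ge>0. \<forall>z\<in>K. norm (f n z) \<le> B" if "n \<in> I" for n
  proof -
    have "bounded (f n ` K)"
      using assms(1,2) that by (intro compact_imp_bounded compact_continuous_image)
    then obtain B where "\<forall>z\<in>K. norm (f n z) \<le> B" by (auto simp: bounded_iff)
    thus ?thesis by (intro exI[of _ "max B 0"]) auto
  qed
  then obtain B where B: "\<And>n. n \<in> I \<Longrightarrow> B n \<ge> 0" "\<And>n z. n \<in> I \<Longrightarrow> z \<in> K \<Longrightarrow> norm (f n z) \<le> B n"
    by metis
  define M where "M = (\<lambda>n. \<bar>c\<bar> * (1 / of_int n ^ 2) + (if \<bar>n\<bar> < k then B n else 0))"
  have sq: "(\<lambda>n::int. 1 / (of_int n :: real)^2) summable_on I"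
    using summable_on_inverse_square_int summable_on_subset_banach by blast
  have fin: "finite {n. \<bar>n\<bar> < k}"
    by (rule finite_subset[of _ "{-k..k}"]) auto
  have "(\<lambda>n. if \<bar>n\<bar> < k then B n else 0) summable_on (I \<inter> {n. \<bar>n\<bar> < k})"
    using fin by (intro summable_on_finite) auto
  hence "(\<lambda>n. if \<bar>n\<bar> < k then B n else 0) summable_on I"
    by (rule summable_on_cong_neutral[THEN iffD1, rotated -1]) auto
  hence "M summable_on I"
    unfolding M_def by (intro summable_on_add summable_on_cmult_right sq)
  moreover have "norm (f n z) \<le> M n" if "n \<in> I" "z \<in> K" for n z
  proof (cases "k \<le> \<bar>n\<bar>")
    case True
    have "norm (f n z) \<le> c / of_int n ^ 2" using bound that True by blast
    also have "\<dots> \<le> \<bar>c\<bar> / of_int n ^ 2" by (intro divide_right_mono) auto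
    finally show ?thesis using True by (simp add: M_def)
  next
    case False
    thus ?thesis using B that by (auto simp: M_def intro: order_trans[OF B(2)])
  qed
  ultimately show ?thesis
    by (intro Weierstrass_m_test_general)
qed

text \<open>
  Both the inner and the outer sum of an Eisenstein series satisfy these hypotheses, so this lemma
  is applied twice. Uniform convergence on closed discs carries over to all derivatives by Cauchy's
  formula; the has-sum form for the differentiated series provides in particular the convergence of
  the Eisenstein series of weight above 2, without estimating them.
\<close>

lemma infsum_int_holomorphic:
  fixes f :: "int \<Rightarrow> complex \<Rightarrow> complex"
  assumes "open S" and hol: "\<And>n. n \<in> I \<Longrightarrow> f n holomorphic_on S"
    and bound: "\<And>R. \<exists>k c. \<forall>n\<in>I. \<forall>z\<in>S. k \<le> \<bar>n\<bar> \<longrightarrow> norm z \<le> R \<longrightarrow> norm (f n z) \<le> c / of_int n ^ 2"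
  shows infsum_int_holomorphic_on: "(\<lambda>z. \<Sum>\<^sub>\<infinity>n\<in>I. f n z) holomorphic_on S"
    and has_sum_higher_deriv_infsum_int:
      "z \<in> S \<Longrightarrow> ((\<lambda>n. (deriv ^^ j) (f n) z) has_sum (deriv ^^ j) (\<lambda>z. \<Sum>\<^sub>\<infinity>n\<in>I. f n z) z) I"
    and uniform_limit_infsum_int_holomorphic: "compact K \<Longrightarrow> K \<subseteq> S \<Longrightarrow>
       uniform_limit K (\<lambda>A z. \<Sum>n\<in>A. f n z) (\<lambda>z. \<Sum>\<^sub>\<infinity>n\<in>I. f n z) (finite_subsets_at_top I)"
proof -
  let ?F = "\<lambda>z. \<Sum>\<^sub>\<infinity>n\<in>I. f n z"
  have hol_sum: "\<forall>\<^sub>F A in finite_subsets_at_top I. (\<lambda>z. \<Sum>n\<in>A. f n z) holomorphic_on S"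
    by (rule eventually_finite_subsets_at_top_weakI) (auto intro!: holomorphic_on_sum hol)
  show unif: "uniform_limit K (\<lambda>A z. \<Sum>n\<in>A. f n z) ?F (finite_subsets_at_top I)"
    if K: "compact K" "K \<subseteq> S" for K
  proof -
    obtain R where R: "\<And>z. z \<in> K \<Longrightarrow> norm z \<le> R"
      using compact_imp_bounded[OF K(1)] by (auto simp: bounded_iff)
    obtain k c where "\<forall>n\<in>I. \<forall>z\<in>S. k \<le> \<bar>n\<bar> \<longrightarrow> norm z \<le> R \<longrightarrow> norm (f n z) \<le> c / of_int n ^ 2"
      using bound by blast
    thus ?thesis using R K
      by (intro uniform_limit_infsum_int[where k = k and c = c])
         (auto intro!: holomorphic_on_imp_continuous_on intro: holomorphic_on_subset[OF hol])
  qed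
  have "?F analytic_on S"
    unfolding analytic_on_def
  proof
    fix z assume "z \<in> S"
    then obtain r where r: "0 < r" "cball z r \<subseteq> S" using \<open>open S\<close> open_contains_cball by blast
    have "?F holomorphic_on ball z r"
    proof (rule holomorphic_uniform_limit)
      show "uniform_limit (cball z r) (\<lambda>A z. \<Sum>n\<in>A. f n z) ?F (finite_subsets_at_top I)"
        using r by (intro unif) auto
      show "\<forall>\<^sub>F A in finite_subsets_at_top I.
          continuous_on (cball z r) (\<lambda>z. \<Sum>n\<in>A. f n z) \<and> (\<lambda>z. \<Sum>n\<in>A. f n z) holomorphic_on ball z r"
        using hol_sum
      proof eventually_elim
        case (elim A)
        hence "(\<lambda>z. \<Sum>n\<in>A. f n z) holomorphic_on cball z r" using r holomorphic_on_subset by blast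
        thus ?case
          using holomorphic_on_imp_continuous_on holomorphic_on_subset ball_subset_cball by blast
      qed
    qed auto
    thus "\<exists>e>0. ?F holomorphic_on ball z e" using r by blast
  qed
  thus "?F holomorphic_on S" by (rule analytic_imp_holomorphic)
  show "((\<lambda>n. (deriv ^^ j) (f n) z) has_sum (deriv ^^ j) ?F z) I" if z: "z \<in> S"
  proof -
    obtain r where r: "0 < r" "cball z r \<subseteq> S" using z \<open>open S\<close> open_contains_cball by blast
    have "((\<lambda>A. (deriv ^^ j) (\<lambda>z. \<Sum>n\<in>A. f n z) z) \<longlongrightarrow> (deriv ^^ j) ?F z) (finite_subsets_at_top I)"
    proof (rule higher_deriv_complex_uniform_limit)
      show "uniform_limit (ball z r) (\<lambda>A z. \<Sum>n\<in>A. f n z) ?F (finite_subsets_at_top I)"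
        using unif[of "cball z r"] r by (meson compact_cball uniform_limit_on_subset ball_subset_cball)
      show "\<forall>\<^sub>F A in finite_subsets_at_top I. (\<lambda>z. \<Sum>n\<in>A. f n z) holomorphic_on ball z r"
        using hol_sum by eventually_elim (use r ball_subset_cball in \<open>blast intro: holomorphic_on_subset\<close>)
    qed (use r in auto)
    moreover have "\<forall>\<^sub>F A in finite_subsets_at_top I.
       (deriv ^^ j) (\<lambda>z. \<Sum>n\<in>A. f n z) z = (\<Sum>n\<in>A. (deriv ^^ j) (f n) z)"
    proof (rule eventually_finite_subsets_at_top_weakI)
      fix A assume A: "finite A" "A \<subseteq> I"
      thus "(deriv ^^ j) (\<lambda>z. \<Sum>n\<in>A. f n z) z = (\<Sum>n\<in>A. (deriv ^^ j) (f n) z)"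
      proof (induction A)
        case (insert n A)
        have "(deriv ^^ j) (\<lambda>z. f n z + (\<Sum>n\<in>A. f n z)) z =
              (deriv ^^ j) (f n) z + (deriv ^^ j) (\<lambda>z. \<Sum>n\<in>A. f n z) z"
          using insert.prems by (intro higher_deriv_add[OF _ _ \<open>open S\<close> z] holomorphic_intros hol) auto
        thus ?case using insert by simp
      qed simp
    qed
    ultimately show ?thesis
      unfolding has_sum_def by (rule Lim_transform_eventually)
  qed
qed


section \<open>The partial fraction expansion of the inverse square of the sine\<close>

lemma one_minus_notin_Ints: "w \<notin> \<int> \<Longrightarrow> 1 - (w::complex) \<notin> \<int>"
  by (metis Ints_1 Ints_diff diff_diff_eq2 add_diff_cancel_left')

text \<open>
  This is the logarithmic derivative of Euler's reflection formula
  \<Gamma>(w) \<Gamma>(1 - w) = \<pi> / sin (\<pi> w).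
\<close>

lemma Digamma_reflection_complex:
  fixes w :: complex
  assumes w: "w \<notin> \<int>"
  shows "Digamma w - Digamma (1 - w) = - of_real pi * cot (of_real pi * w)"
proof -
  have w': "1 - w \<notin> \<int>" using w by (rule one_minus_notin_Ints)
  have nz: "sin (of_real pi * w) \<noteq> 0" using w by (auto simp: sin_eq_0 mult.commute)
  have ni: "w \<notin> \<int>\<^sub>\<le>\<^sub>0" "1 - w \<notin> \<int>\<^sub>\<le>\<^sub>0" using w w' nonpos_Ints_Int by blast+
  have "((\<lambda>w. Gamma w * Gamma (1 - w)) has_field_derivative
          (Gamma w * Digamma w * Gamma (1 - w) - Gamma w * (Gamma (1 - w) * Digamma (1 - w)))) (at w)"
    using ni by (auto intro!: derivative_eq_intros)
  moreover have "((\<lambda>w. of_real pi / sin (of_real pi * w)) has_field_derivative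
          (- of_real pi * (of_real pi * cos (of_real pi * w)) / sin (of_real pi * w) ^ 2)) (at w)"
    using nz by (auto intro!: derivative_eq_intros simp: power2_eq_square)
  ultimately have "Gamma w * Digamma w * Gamma (1 - w) - Gamma w * (Gamma (1 - w) * Digamma (1 - w)) =
      - of_real pi * (of_real pi * cos (of_real pi * w)) / sin (of_real pi * w) ^ 2"
    unfolding Gamma_reflection_complex by (rule DERIV_unique)
  hence "(Gamma w * Gamma (1 - w)) * (Digamma w - Digamma (1 - w)) =
      - of_real pi * (of_real pi * cos (of_real pi * w)) / sin (of_real pi * w) ^ 2"
    by (simp add: algebra_simps)
  moreover have "Digamma w - Digamma (1 - w) =
      (Gamma w * Gamma (1 - w)) * (Digamma w - Digamma (1 - w)) * (sin (of_real pi * w) / of_real pi)"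
    using nz by (simp add: Gamma_reflection_complex)
  ultimately show ?thesis
    using nz by (simp add: cot_def power2_eq_square)
qed

lemma Polygamma_1_reflection_complex:
  fixes w :: complex
  assumes w: "w \<notin> \<int>"
  shows "Polygamma 1 w + Polygamma 1 (1 - w) = (of_real pi / sin (of_real pi * w))^2"
proof -
  have w': "1 - w \<notin> \<int>" using w by (rule one_minus_notin_Ints)
  have nz: "sin (of_real pi * w) \<noteq> 0" using w by (auto simp: sin_eq_0 mult.commute)
  have ni: "w \<notin> \<int>\<^sub>\<le>\<^sub>0" "1 - w \<notin> \<int>\<^sub>\<le>\<^sub>0" using w w' nonpos_Ints_Int by blast+
  have "((\<lambda>w. Digamma w - Digamma (1 - w)) has_field_derivative
          Polygamma 1 w + Polygamma 1 (1 - w)) (at w)"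
    using ni by (auto intro!: derivative_eq_intros)
  moreover have "((\<lambda>w. - of_real pi * cot (of_real pi * w)) has_field_derivative
          (of_real pi / sin (of_real pi * w))^2) (at w)"
    using nz by (auto intro!: derivative_eq_intros DERIV_chain2[OF DERIV_cot] simp: power2_eq_square field_simps)
  moreover have ev: "\<forall>\<^sub>F z in nhds w. Digamma z - Digamma (1 - z) = - of_real pi * cot (of_real pi * z)"
  proof -
    have "\<forall>\<^sub>F z in nhds w. z \<in> - \<int>"
      using w by (intro eventually_nhds_in_open) (auto simp: closed_Ints open_Compl)
    thus ?thesis by eventually_elim (simp add: Digamma_reflection_complex)
  qed
  ultimately show ?thesis
    using DERIV_cong_ev[OF refl ev refl] DERIV_unique by blast
qed

text \<open>
  For m = 0 both sides vanish: then R is not positive, so w = 0, and 1 / 0 = 0.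
\<close>

lemma norm_inverse_square_shift_le:
  fixes w :: complex and m :: int
  assumes "norm w \<le> R" "2 * R \<le> real_of_int \<bar>m\<bar>"
  shows "norm (1 / (of_int m + w)^2) \<le> 4 / of_int m ^ 2"
proof (cases "m = 0")
  case True
  hence "norm w \<le> 0" using assms by linarith
  hence "w = 0" by simp
  thus ?thesis using True by simp
next
  case False
  have "\<bar>real_of_int m\<bar> \<le> norm (of_int m + w) + norm w"
    using norm_triangle_ineq4[of "of_int m + w" w] by simp
  hence "\<bar>real_of_int m\<bar> / 2 \<le> norm (of_int m + w)" using assms by simp
  hence "(\<bar>real_of_int m\<bar> / 2)^2 \<le> norm (of_int m + w)^2" by (intro power_mono) auto
  hence "1 / norm (of_int m + w)^2 \<le> 1 / (\<bar>real_of_int m\<bar> / 2)^2"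
    using False by (intro divide_left_mono mult_pos_pos) (auto intro: less_le_trans)
  thus ?thesis by (simp add: norm_divide norm_power power_divide)
qed

lemma has_field_derivative_inverse_power_shift:
  fixes b c z :: complex
  assumes "b + z \<noteq> 0"
  shows "((\<lambda>x. c / (b + x) ^ Suc k) has_field_derivative
            - (c * of_nat (Suc k)) / (b + z) ^ Suc (Suc k)) (at z)"
proof -
  have "((\<lambda>x. inverse (b + x)) has_field_derivative - (inverse (b + z) ^ Suc (Suc 0))) (at z)"
    using assms by (auto intro!: derivative_eq_intros)
  from DERIV_cmult[OF DERIV_power_Suc[OF this, of k], of c]
  have "((\<lambda>x. c * inverse (b + x) ^ Suc k) has_field_derivative
          c * ((1 + of_nat k) * (- (inverse (b + z) ^ Suc (Suc 0)) * inverse (b + z) ^ k))) (at z)" .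
  also have "c * ((1 + of_nat k) * (- (inverse (b + z) ^ Suc (Suc 0)) * inverse (b + z) ^ k)) =
      - (c * of_nat (Suc k)) / (b + z) ^ Suc (Suc k)"
    by (simp add: divide_inverse power_inverse mult_ac)
  finally show ?thesis by (simp add: divide_inverse power_inverse)
qed

lemma higher_deriv_inverse_square_shift:
  fixes b z :: complex
  assumes "b + z \<noteq> 0"
  shows "(deriv ^^ j) (\<lambda>x. 1 / (b + x)^2) z = (- 1) ^ j * fact (Suc j) / (b + z) ^ (j + 2)"
  using assms
proof (induction j arbitrary: z)
  case (Suc j)
  have "\<forall>\<^sub>F x in nhds z. x \<in> - {- b}"
    using Suc.prems by (intro eventually_nhds_in_open) (auto simp: add_eq_0_iff)
  hence "\<forall>\<^sub>F x in nhds z. (deriv ^^ j) (\<lambda>x. 1 / (b + x)^2) x =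
           (- 1) ^ j * fact (Suc j) / (b + x) ^ Suc (Suc j)"
    by eventually_elim (use Suc.IH in \<open>auto simp: add_eq_0_iff\<close>)
  hence "(deriv ^^ Suc j) (\<lambda>x. 1 / (b + x)^2) z =
           deriv (\<lambda>x. (- 1) ^ j * fact (Suc j) / (b + x) ^ Suc (Suc j)) z"
    by (simp only: funpow.simps o_apply) (rule deriv_cong_ev, auto)
  also have "\<dots> = - ((- 1) ^ j * fact (Suc j) * of_nat (Suc (Suc j))) / (b + z) ^ Suc (Suc (Suc j))"
    by (intro DERIV_imp_deriv has_field_derivative_inverse_power_shift Suc.prems)
  finally show ?case by (simp add: mult_ac)
qed (simp add: power2_eq_square)

text \<open>
  A single row of the lattice, with an arbitrary set J of columns so that the pole at the origin can
  be left out.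
\<close>

lemma
  fixes J :: "int set" and a :: complex
  defines "S \<equiv> {z. \<forall>m\<in>J. of_int m + (a + z) \<noteq> 0}"
  shows open_lattice_row: "open S"
    and infsum_row_holomorphic_on: "(\<lambda>z. \<Sum>\<^sub>\<infinity>m\<in>J. 1 / (of_int m + (a + z))^2) holomorphic_on S"
    and has_sum_higher_deriv_row: "z \<in> S \<Longrightarrow>
      ((\<lambda>m. (- 1) ^ j * fact (Suc j) / (of_int m + (a + z)) ^ (j + 2)) has_sum
         (deriv ^^ j) (\<lambda>z. \<Sum>\<^sub>\<infinity>m\<in>J. 1 / (of_int m + (a + z))^2) z) J"
proof -
  have "closed ((\<lambda>m::int. - (of_int m + a)) ` J)"
  proof -
    have "closed ((\<lambda>z. - a + z) ` uminus ` of_int ` J)"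
      by (intro closed_translation closed_negations closed_of_int_image)
    moreover have "- a + - of_int m = - (of_int m + a)" for m :: int by simp
    ultimately show ?thesis by (simp only: image_image)
  qed
  moreover have "S = - ((\<lambda>m::int. - (of_int m + a)) ` J)"
  proof -
    have "x = - (of_int m + a) \<longleftrightarrow> of_int m + (a + x) = 0" for m :: int and x :: complex
      using eq_neg_iff_add_eq_0[of x "of_int m + a"] by (simp add: add_ac)
    thus ?thesis by (auto simp: S_def)
  qed
  ultimately show "open S" by (simp add: open_Compl)
  have hol: "(\<lambda>z. 1 / (of_int m + (a + z))^2) holomorphic_on S" if "m \<in> J" for m
    using that by (auto intro!: holomorphic_intros simp: S_def)
  have bound: "\<exists>k c. \<forall>m\<in>J. \<forall>z\<in>S. k \<le> \<bar>m\<bar> \<longrightarrow> norm z \<le> R \<longrightarrow>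
      norm (1 / (of_int m + (a + z))^2) \<le> c / of_int m ^ 2" for R
  proof (intro exI ballI impI)
    fix m :: int and z :: complex
    assume "\<lceil>2 * (norm a + R)\<rceil> \<le> \<bar>m\<bar>" "norm z \<le> R"
    thus "norm (1 / (of_int m + (a + z))^2) \<le> 4 / of_int m ^ 2"
      by (intro norm_inverse_square_shift_le[where R = "norm a + R"])
         (auto intro: norm_triangle_le simp: ceiling_le_iff)
  qed
  note * = infsum_int_holomorphic[OF \<open>open S\<close> hol bound]
  show "(\<lambda>z. \<Sum>\<^sub>\<infinity>m\<in>J. 1 / (of_int m + (a + z))^2) holomorphic_on S" by (rule *)
  assume z: "z \<in> S"
  have "(deriv ^^ j) (\<lambda>z. 1 / (of_int m + (a + z))^2) z =
      (- 1) ^ j * fact (Suc j) / (of_int m + (a + z)) ^ (j + 2)" if "m \<in> J" for m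
    using higher_deriv_inverse_square_shift[of "of_int m + a" z j] z that
    by (auto simp: S_def add.assoc)
  thus "((\<lambda>m. (- 1) ^ j * fact (Suc j) / (of_int m + (a + z)) ^ (j + 2)) has_sum
         (deriv ^^ j) (\<lambda>z. \<Sum>\<^sub>\<infinity>m\<in>J. 1 / (of_int m + (a + z))^2) z) J"
    using *(2)[OF _ z, of j] by (simp cong: has_sum_cong)
qed

text \<open>
  The non-negative m contribute Polygamma 1 w and the negative ones, written as m = - k - 1, contribute
  Polygamma 1 (1 - w), so the closed form is the derivative of the reflection formula for Digamma.
\<close>

lemma has_sum_inverse_square_complex:
  fixes w :: complex
  assumes w: "w \<notin> \<int>"
  shows "((\<lambda>m::int. 1 / (of_int m + w)^2) has_sum (of_real pi / sin (of_real pi * w))^2) UNIV"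
proof -
  have ser: "((\<lambda>k::nat. 1 / (of_nat k + z)^2) has_sum Polygamma 1 z) UNIV" if z: "z \<notin> \<int>" for z :: complex
  proof -
    have "z \<noteq> 0" using z by auto
    hence "(\<lambda>k. inverse ((z + of_nat k) ^ Suc 1)) sums ((- 1) ^ Suc 1 * Polygamma 1 z / fact 1)"
      using Polygamma_LIMSEQ[of z 1] by simp
    hence "(\<lambda>k. 1 / (of_nat k + z)^2) sums Polygamma 1 z"
      by (simp add: field_simps power2_eq_square)
    moreover have "(\<lambda>k. 1 / (of_nat k + z)^2) summable_on UNIV"
    proof -
      have "0 \<in> {x. \<forall>m\<in>range int. of_int m + (z + x) \<noteq> 0}"
      proof -
        have "of_int m + (z + 0) \<noteq> 0" for m
          using that minus_in_Ints_iff[of z] Ints_of_int[of m, where 'a = complex]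
          by (auto simp: add_eq_0_iff2 simp del: Ints_of_int)
        thus ?thesis by blast
      qed
      from has_sum_higher_deriv_row[OF this, of 0]
      have "(\<lambda>m. 1 / (of_int m + z)^2) summable_on range int"
        by (auto simp: summable_on_def power2_eq_square)
      thus ?thesis by (subst (asm) summable_on_reindex) (auto simp: o_def)
    qed
    ultimately show ?thesis
      using has_sum_imp_sums has_sum_infsum sums_unique2 by metis
  qed
  have "((\<lambda>m. 1 / (of_int m + w)^2) has_sum Polygamma 1 w) (range int)"
    by (subst has_sum_reindex) (use ser[OF w] in \<open>auto simp: o_def\<close>)
  moreover have "((\<lambda>m. 1 / (of_int m + w)^2) has_sum Polygamma 1 (1 - w)) (range (\<lambda>k. - int k - 1))"
  proof (subst has_sum_reindex)
    have "(1 / (of_nat k + (1 - w))^2) = 1 / (of_int (- int k - 1) + w)^2" for k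
      by (simp add: power2_eq_square algebra_simps)
    thus "((\<lambda>m. 1 / (of_int m + w)^2) \<circ> (\<lambda>k. - int k - 1) has_sum Polygamma 1 (1 - w)) UNIV"
      using ser[OF one_minus_notin_Ints[OF w]] by (simp add: o_def)
  qed (auto simp: inj_on_def)
  ultimately have "((\<lambda>m. 1 / (of_int m + w)^2) has_sum (Polygamma 1 w + Polygamma 1 (1 - w)))
      (range int \<union> range (\<lambda>k. - int k - 1))"
    by (rule has_sum_Un_disjoint) auto
  also have "range int \<union> range (\<lambda>k. - int k - 1) = UNIV"
  proof -
    have "m \<in> range int \<union> range (\<lambda>k. - int k - 1)" for m
      by (cases m) auto
    thus ?thesis by blast
  qed
  finally show ?thesis using Polygamma_1_reflection_complex[OF w] by simp
qed

lemma norm_sin_ge_abs_Im: "\<bar>Im z\<bar> / 2 \<le> norm (sin z)"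
proof (rule power2_le_imp_le)
  have aux: "y / 2 \<le> sinh y" if "y \<ge> 0" for y :: real
  proof -
    have "1 + y \<le> exp y" "exp (- y) \<le> 1" using that by auto
    hence "((1 + y) - 1) / 2 \<le> (exp y - exp (- y)) / 2" by (intro divide_right_mono diff_mono) auto
    thus ?thesis by (simp add: sinh_field_def)
  qed
  have "(\<bar>Im z\<bar> / 2)^2 \<le> (sinh \<bar>Im z\<bar>)^2"
    by (intro power_mono aux) auto
  also have "\<dots> = (exp (2 * Im z) + inverse (exp (2 * Im z)) - 2) / 4"
  proof -
    have "(sinh \<bar>Im z\<bar>)^2 = ((exp (Im z) - inverse (exp (Im z))) / 2)^2"
      using power2_commute[of "exp (Im z)" "inverse (exp (Im z))"]
      by (simp add: abs_if sinh_field_def exp_minus power_divide)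
    also have "\<dots> = (exp (Im z) ^ 2 + inverse (exp (Im z) ^ 2) - 2) / 4"
      by (simp add: power2_eq_square field_simps)
    finally show ?thesis by (simp add: exp_double)
  qed
  also have "\<dots> \<le> norm (sin z)^2"
    unfolding norm_sin_squared using cos_le_one[of "2 * Re z"] by simp
  finally show "(\<bar>Im z\<bar> / 2)^2 \<le> norm (sin z)^2" .
qed auto

text \<open>
  Bounding the series term by term only gives a decay of order 1 / |Im w|, which is not summable over
  the rows of a lattice. The closed form, whose true decay is exponential, gives the order 2 that
  makes the iterated sum of weight 2 converge absolutely in its outer index.
\<close>

lemma norm_infsum_inverse_square_le:
  fixes w :: complex
  assumes "Im w \<noteq> 0"
  shows "norm (\<Sum>\<^sub>\<infinity>m::int. 1 / (of_int m + w)^2) \<le> 4 / (Im w)^2"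
proof -
  have w: "w \<notin> \<int>" using assms by (auto elim!: Ints_cases)
  have "pi * \<bar>Im w\<bar> / 2 \<le> norm (sin (of_real pi * w))"
    using norm_sin_ge_abs_Im[of "of_real pi * w"] by (simp add: abs_mult)
  moreover have "sin (of_real pi * w) \<noteq> 0" using w by (auto simp: sin_eq_0 mult.commute)
  ultimately have "pi / norm (sin (of_real pi * w)) \<le> pi / (pi * \<bar>Im w\<bar> / 2)"
    using assms by (intro divide_left_mono mult_pos_pos) (auto intro: less_le_trans)
  hence "(pi / norm (sin (of_real pi * w)))^2 \<le> (2 / \<bar>Im w\<bar>)^2"
    by (intro power_mono) auto
  thus ?thesis
    by (simp add: infsumI[OF has_sum_inverse_square_complex[OF w]] norm_power norm_divide power_divide)
qed

section \<open>Eisenstein series\<close>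

text \<open>
  The lattice sum without its term at the origin. It is regular at 0, where its value is the
  Eisenstein series of the lattice, and away from the lattice it differs from the sum over the
  whole lattice by 1 / z^s, so one function serves both kinds of Eisenstein series.
\<close>

definition punctured_eisenstein :: "nat \<Rightarrow> complex \<Rightarrow> complex \<Rightarrow> complex" where
  "punctured_eisenstein s \<tau> z =
     (\<Sum>\<^sub>\<infinity>n::int. \<Sum>\<^sub>\<infinity>m\<in>{m::int. n = 0 \<longrightarrow> m \<noteq> 0}. 1 / (of_int m + (of_int n * \<tau> + z)) ^ s)"

lemma eisenstein_eq_punctured: "eisenstein s \<tau> = punctured_eisenstein s \<tau> 0"
  by (simp add: eisenstein_def punctured_eisenstein_def)

lemma period_latticeI: "of_int m + of_int n * \<tau> \<in> period_lattice \<tau>"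
  by (auto simp: period_lattice_def)

lemma zero_in_period_lattice: "0 \<in> period_lattice \<tau>"
  using period_latticeI[of 0 0] by simp

lemma lattice_shift_eq_0D:
  assumes "of_int m + (of_int n * \<tau> + z) = 0"
  shows "z \<in> period_lattice \<tau>"
proof -
  have "z = of_int (- m) + of_int (- n) * \<tau>" using assms by (simp add: algebra_simps eq_neg_iff_add_eq_0)
  thus ?thesis by (simp only: period_latticeI)
qed

lemma diff_in_period_lattice:
  assumes "z \<in> period_lattice \<tau>" "w \<in> period_lattice \<tau>"
  shows "z - w \<in> period_lattice \<tau>"
proof -
  from assms obtain m n m' n' where "z = of_int m + of_int n * \<tau>" "w = of_int m' + of_int n' * \<tau>"
    by (auto simp: period_lattice_def)
  hence "z - w = of_int (m - m') + of_int (n - n') * \<tau>" by (simp add: algebra_simps)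
  thus ?thesis by (simp only: period_latticeI)
qed

lemma add_in_period_lattice_iff:
  assumes "w \<in> period_lattice \<tau>"
  shows "z + w \<in> period_lattice \<tau> \<longleftrightarrow> z \<in> period_lattice \<tau>"
proof
  assume "z + w \<in> period_lattice \<tau>"
  from diff_in_period_lattice[OF this assms] show "z \<in> period_lattice \<tau>" by simp
next
  assume "z \<in> period_lattice \<tau>"
  from diff_in_period_lattice[OF this diff_in_period_lattice[OF zero_in_period_lattice assms]]
  show "z + w \<in> period_lattice \<tau>" by simp
qed

lemma periods_in_period_lattice: "1 \<in> period_lattice \<tau>" "\<tau> \<in> period_lattice \<tau>"
  using period_latticeI[of 1 0 \<tau>] period_latticeI[of 0 1 \<tau>] by simp_all

text \<open>
  The domain on which the punctured sums are holomorphic. It contains the origin.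
\<close>

definition off_nonzero_lattice :: "complex \<Rightarrow> complex set" where
  "off_nonzero_lattice \<tau> = - (period_lattice \<tau> - {0})"

context
  fixes \<tau> :: complex
  assumes \<tau>: "Im \<tau> > 0"
begin

lemma lattice_eq_0_iff: "of_int m + of_int n * \<tau> = 0 \<longleftrightarrow> m = 0 \<and> n = 0"
proof
  assume *: "of_int m + of_int n * \<tau> = 0"
  hence "Im (of_int m + of_int n * \<tau>) = 0" by simp
  hence "n = 0" using \<tau> by simp
  thus "m = 0 \<and> n = 0" using * by simp
qed simp

text \<open>
  Distinct lattice points have distance at least min 1 (Im \<tau>): a shorter difference lies in
  row 0 by its imaginary part, hence is an integer of absolute value less than 1.
\<close>

lemma closed_subset_period_lattice:
  assumes "A \<subseteq> period_lattice \<tau>"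
  shows "closed A"
proof (rule discrete_imp_closed)
  show "0 < min 1 (Im \<tau>)" using \<tau> by simp
  show "\<forall>x\<in>A. \<forall>y\<in>A. dist y x < min 1 (Im \<tau>) \<longrightarrow> y = x"
  proof safe
    fix x y assume "x \<in> A" "y \<in> A" and lt: "dist y x < min 1 (Im \<tau>)"
    then obtain m n where mn: "y - x = of_int m + of_int n * \<tau>"
      using assms diff_in_period_lattice[of y \<tau> x] unfolding period_lattice_def by blast
    have "\<bar>of_int n\<bar> * Im \<tau> < 1 * Im \<tau>"
    proof -
      have "\<bar>of_int n\<bar> * Im \<tau> = \<bar>Im (y - x)\<bar>" using \<tau> unfolding mn by (simp add: abs_mult)
      also have "\<dots> \<le> dist y x" unfolding dist_norm by (rule abs_Im_le_cmod)
      finally show ?thesis using lt by simp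
    qed
    hence "\<bar>of_int n\<bar> < (1 :: real)" using \<tau> mult_less_cancel_right_pos by blast
    hence "n = 0" by simp
    moreover from \<open>n = 0\<close> have "\<bar>of_int m\<bar> < (1 :: real)" using lt mn by (simp add: dist_norm)
    hence "m = 0" by simp
    ultimately show "y = x" using mn by simp
  qed
qed

lemma off_nonzero_lattice_nonzero:
  assumes "z \<in> off_nonzero_lattice \<tau>" "n = 0 \<longrightarrow> m \<noteq> 0"
  shows "of_int m + (of_int n * \<tau> + z) \<noteq> 0"
  using assms lattice_shift_eq_0D[of m n \<tau> z] lattice_eq_0_iff[of m n]
  by (auto simp: off_nonzero_lattice_def)

lemma open_off_nonzero_lattice: "open (off_nonzero_lattice \<tau>)"
  unfolding off_nonzero_lattice_def
  by (rule open_Compl, rule closed_subset_period_lattice) auto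

text \<open>
  A row other than row 0 is a full row, so it is controlled by the distance of its points from the
  real axis, which is at least half of |n| Im \<tau> as soon as |z| is at most the other half.
\<close>

lemma norm_eisenstein_row_le:
  fixes n :: int
  assumes "norm z \<le> R" "2 * R \<le> \<bar>of_int n\<bar> * Im \<tau>" "n \<noteq> 0"
  shows "norm (\<Sum>\<^sub>\<infinity>m\<in>{m::int. n = 0 \<longrightarrow> m \<noteq> 0}. 1 / (of_int m + (of_int n * \<tau> + z)) ^ 2)
           \<le> 16 / (Im \<tau>)^2 / of_int n ^ 2"
proof -
  let ?w = "of_int n * \<tau> + z"
  have Im: "\<bar>of_int n\<bar> * Im \<tau> / 2 \<le> \<bar>Im ?w\<bar>"
  proof -
    have "\<bar>of_int n\<bar> * Im \<tau> = \<bar>Im ?w - Im z\<bar>" using \<tau> by (simp add: abs_mult)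
    thus ?thesis using abs_Im_le_cmod[of z] assms by linarith
  qed
  have pos: "0 < \<bar>of_int n\<bar> * Im \<tau>" using \<tau> assms by simp
  have "norm (\<Sum>\<^sub>\<infinity>m::int. 1 / (of_int m + ?w) ^ 2) \<le> 4 / (Im ?w)^2"
    using Im pos by (intro norm_infsum_inverse_square_le) linarith
  also have "\<dots> \<le> 4 / (\<bar>of_int n\<bar> * Im \<tau> / 2)^2"
  proof (intro divide_left_mono mult_pos_pos)
    show "(\<bar>of_int n\<bar> * Im \<tau> / 2)^2 \<le> (Im ?w)^2"
      using power_mono[OF Im, of 2] pos by simp
    show "0 < (Im ?w)^2" using Im pos by (subst zero_less_power2) linarith
      show "0 < (\<bar>of_int n\<bar> * Im \<tau> / 2)^2" using pos by (intro zero_less_power) auto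
  qed auto
  also have "\<dots> = 16 / (Im \<tau>)^2 / of_int n ^ 2" by (simp add: power_mult_distrib power_divide)
  finally show ?thesis using assms by simp
qed

text \<open>
  Only weight 2 needs estimates. The higher weights are its derivatives up to a constant, first
  within a row and then across the rows; their convergence comes with the differentiation.
\<close>

lemma
  shows punctured_eisenstein_holomorphic_on: "punctured_eisenstein 2 \<tau> holomorphic_on off_nonzero_lattice \<tau>"
    and higher_deriv_punctured_eisenstein: "z \<in> off_nonzero_lattice \<tau> \<Longrightarrow>
      (deriv ^^ j) (punctured_eisenstein 2 \<tau>) z =
        (- 1) ^ j * fact (Suc j) * punctured_eisenstein (j + 2) \<tau> z"
    and has_sum_punctured_eisenstein: "z \<in> off_nonzero_lattice \<tau> \<Longrightarrow>
      ((\<lambda>n. \<Sum>\<^sub>\<infinity>m\<in>{m. n = 0 \<longrightarrow> m \<noteq> 0}. 1 / (of_int m + (of_int n * \<tau> + z)) ^ (j + 2)) has_sum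
         punctured_eisenstein (j + 2) \<tau> z) UNIV"
    and uniform_limit_punctured_eisenstein: "compact K \<Longrightarrow> K \<subseteq> off_nonzero_lattice \<tau> \<Longrightarrow>
      uniform_limit K (\<lambda>A z. \<Sum>n\<in>A. \<Sum>\<^sub>\<infinity>m\<in>{m. n = 0 \<longrightarrow> m \<noteq> 0}. 1 / (of_int m + (of_int n * \<tau> + z)) ^ 2)
        (punctured_eisenstein 2 \<tau>) (finite_subsets_at_top UNIV)"
proof -
  let ?row = "\<lambda>s n z. \<Sum>\<^sub>\<infinity>m\<in>{m. n = 0 \<longrightarrow> m \<noteq> 0}. 1 / (of_int m + (of_int n * \<tau> + z)) ^ s"
  have sub: "off_nonzero_lattice \<tau> \<subseteq> {z. \<forall>m\<in>{m. n = 0 \<longrightarrow> m \<noteq> 0}. of_int m + (of_int n * \<tau> + z) \<noteq> 0}" for n :: int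
    by (intro subsetI CollectI ballI off_nonzero_lattice_nonzero) auto
  have hol: "?row 2 n holomorphic_on off_nonzero_lattice \<tau>" for n
    using infsum_row_holomorphic_on sub by (rule holomorphic_on_subset)
  have bound: "\<exists>k c. \<forall>n\<in>UNIV. \<forall>z\<in>off_nonzero_lattice \<tau>. k \<le> \<bar>n\<bar> \<longrightarrow> norm z \<le> R \<longrightarrow>
                 norm (?row 2 n z) \<le> c / of_int n ^ 2" for R
  proof (intro exI ballI impI)
    fix n :: int and z :: complex
    assume k: "max 1 \<lceil>2 * R / Im \<tau>\<rceil> \<le> \<bar>n\<bar>" and R: "norm z \<le> R"
    show "norm (?row 2 n z) \<le> 16 / (Im \<tau>)^2 / of_int n ^ 2"
    proof (rule norm_eisenstein_row_le[OF R])
      show "n \<noteq> 0" using k by auto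
      have "2 * R / Im \<tau> \<le> \<bar>of_int n\<bar>" using k by (auto simp: ceiling_le_iff)
      thus "2 * R \<le> \<bar>of_int n\<bar> * Im \<tau>" using \<tau> by (simp add: field_simps)
    qed
  qed
  note * = infsum_int_holomorphic[where S = "off_nonzero_lattice \<tau>" and I = UNIV and f = "?row 2", OF open_off_nonzero_lattice hol bound]
  have fold: "(\<lambda>z. \<Sum>\<^sub>\<infinity>n. ?row 2 n z) = punctured_eisenstein 2 \<tau>"
    by (simp add: fun_eq_iff punctured_eisenstein_def)
  show "punctured_eisenstein 2 \<tau> holomorphic_on off_nonzero_lattice \<tau>" using *(1) unfolding fold .
  show "uniform_limit K (\<lambda>A z. \<Sum>n\<in>A. ?row 2 n z)
        (punctured_eisenstein 2 \<tau>) (finite_subsets_at_top UNIV)" if "compact K" "K \<subseteq> off_nonzero_lattice \<tau>"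
    using *(3)[OF that] unfolding fold .
  assume z: "z \<in> off_nonzero_lattice \<tau>"
  define c :: complex where "c = (- 1) ^ j * fact (Suc j)"
  have c: "c \<noteq> 0" by (simp add: c_def del: fact_Suc)
  have row: "(deriv ^^ j) (?row 2 n) z = c * ?row (j + 2) n z" for n
  proof -
    have "((\<lambda>m. c * (1 / (of_int m + (of_int n * \<tau> + z)) ^ (j + 2))) has_sum (deriv ^^ j) (?row 2 n) z)
            {m. n = 0 \<longrightarrow> m \<noteq> 0}"
      using has_sum_higher_deriv_row[of z "{m. n = 0 \<longrightarrow> m \<noteq> 0}" "of_int n * \<tau>" j] sub[of n] z
      by (auto simp: c_def)
    from infsumI[OF this] show ?thesis by (simp only: infsum_cmult_right')
  qed
  have "((\<lambda>n. c * ?row (j + 2) n z) has_sum (deriv ^^ j) (punctured_eisenstein 2 \<tau>) z) UNIV"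
    using *(2)[OF z, of j] unfolding fold row .
  from has_sum_cmult_right[OF this, of "1 / c"]
  have sum: "((\<lambda>n. ?row (j + 2) n z) has_sum (deriv ^^ j) (punctured_eisenstein 2 \<tau>) z / c) UNIV"
    using c by simp
  have val: "punctured_eisenstein (j + 2) \<tau> z = (deriv ^^ j) (punctured_eisenstein 2 \<tau>) z / c"
    unfolding punctured_eisenstein_def[of "j + 2"] using sum by (rule infsumI)
  thus "(deriv ^^ j) (punctured_eisenstein 2 \<tau>) z =
        (- 1) ^ j * fact (Suc j) * punctured_eisenstein (j + 2) \<tau> z"
    unfolding c_def[symmetric] using c by simp
  show "((\<lambda>n. ?row (j + 2) n z) has_sum punctured_eisenstein (j + 2) \<tau> z) UNIV"
    using sum unfolding val .
qed

lemma eisenstein_row_split: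
  assumes z: "z \<notin> period_lattice \<tau>"
  shows "(\<Sum>\<^sub>\<infinity>m::int. 1 / (of_int m + (of_int n * \<tau> + z)) ^ (j + 2)) =
    (\<Sum>\<^sub>\<infinity>m\<in>{m. n = 0 \<longrightarrow> m \<noteq> 0}. 1 / (of_int m + (of_int n * \<tau> + z)) ^ (j + 2)) +
    (if n = 0 then 1 / z ^ (j + 2) else 0)"
proof (cases "n = 0")
  case True
  define c where "c = (- 1) ^ j * (fact (Suc j) :: complex)"
  have c: "c \<noteq> 0" by (simp add: c_def del: fact_Suc)
  have "z \<in> {z. \<forall>m\<in>-{0}. of_int m + (0 + z) \<noteq> 0}"
    using z lattice_shift_eq_0D[of _ 0 \<tau> z] by auto
  from has_sum_higher_deriv_row[OF this, of j]
  have "(\<lambda>m. c * (1 / (of_int m + z) ^ (j + 2))) summable_on -{0}"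
    unfolding c_def summable_on_def by auto
  from summable_on_cmult_right[OF this, of "1 / c"]
  have "(\<lambda>m. 1 / (of_int m + z) ^ (j + 2)) summable_on -{0}" using c by simp
  hence "((\<lambda>m. 1 / (of_int m + z) ^ (j + 2)) has_sum
           1 / (of_int 0 + z) ^ (j + 2) + (\<Sum>\<^sub>\<infinity>m\<in>-{0}. 1 / (of_int m + z) ^ (j + 2))) (insert 0 (- {0::int}))"
    by (intro has_sum_insert has_sum_infsum) auto
  moreover have "insert 0 (- {0::int}) = UNIV" by auto
  moreover have "{m::int. m \<noteq> 0} = -{0}" by auto
  ultimately show ?thesis using True by (simp add: infsumI add.commute)
qed simp

lemma eisenstein_at_eq_punctured:
  assumes z: "z \<notin> period_lattice \<tau>"
  shows "eisenstein_at (j + 2) z \<tau> = punctured_eisenstein (j + 2) \<tau> z + 1 / z ^ (j + 2)"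
proof -
  have "z \<in> off_nonzero_lattice \<tau>" using z by (simp add: off_nonzero_lattice_def)
  note has_sum_punctured_eisenstein[OF this, of j]
  moreover have "((\<lambda>n::int. if n = 0 then 1 / z ^ (j + 2) else 0) has_sum 1 / z ^ (j + 2)) UNIV"
    by (rule has_sum_finite_neutralI[of "{0}"]) auto
  ultimately have "((\<lambda>n. (\<Sum>\<^sub>\<infinity>m::int. 1 / (of_int m + (of_int n * \<tau> + z)) ^ (j + 2))) has_sum
      punctured_eisenstein (j + 2) \<tau> z + 1 / z ^ (j + 2)) UNIV"
    unfolding eisenstein_row_split[OF z] by (rule has_sum_add)
  thus ?thesis by (simp add: eisenstein_at_def infsumI add.assoc)
qed

lemma higher_deriv_eisenstein_at:
  assumes z: "z \<notin> period_lattice \<tau>"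
  shows "(deriv ^^ j) (\<lambda>z. eisenstein_at 2 z \<tau>) z = (- 1) ^ j * fact (Suc j) * eisenstein_at (j + 2) z \<tau>"
proof -
  have op: "open (- period_lattice \<tau>)" by (intro open_Compl closed_subset_period_lattice order.refl)
  hence "\<forall>\<^sub>F x in nhds z. x \<in> - period_lattice \<tau>" using z by (intro eventually_nhds_in_open) auto
  hence "\<forall>\<^sub>F x in nhds z. eisenstein_at 2 x \<tau> = punctured_eisenstein 2 \<tau> x + 1 / (0 + x)^2"
    by eventually_elim (use eisenstein_at_eq_punctured[of _ 0, unfolded add_0] in simp)
  hence "(deriv ^^ j) (\<lambda>z. eisenstein_at 2 z \<tau>) z =
         (deriv ^^ j) (\<lambda>x. punctured_eisenstein 2 \<tau> x + 1 / (0 + x)^2) z"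
    by (rule higher_deriv_cong_ev) auto
  also have "\<dots> = (deriv ^^ j) (punctured_eisenstein 2 \<tau>) z + (deriv ^^ j) (\<lambda>x. 1 / (0 + x)^2) z"
  proof (rule higher_deriv_add[OF _ _ op])
    show "punctured_eisenstein 2 \<tau> holomorphic_on - period_lattice \<tau>"
      by (rule holomorphic_on_subset[OF punctured_eisenstein_holomorphic_on]) (auto simp: off_nonzero_lattice_def)
    show "(\<lambda>x. 1 / (0 + x)^2) holomorphic_on - period_lattice \<tau>"
      using zero_in_period_lattice[of \<tau>] by (auto intro!: holomorphic_intros)
  qed (use z in auto)
  also have "\<dots> = (- 1) ^ j * fact (Suc j) * eisenstein_at (j + 2) z \<tau>"
  proof -
    have "z \<in> off_nonzero_lattice \<tau>" "0 + z \<noteq> 0" using z zero_in_period_lattice[of \<tau>] by (auto simp: off_nonzero_lattice_def)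
    from higher_deriv_punctured_eisenstein[OF this(1), of j] higher_deriv_inverse_square_shift[OF this(2), of j]
    show ?thesis by (simp only: eisenstein_at_eq_punctured[OF z]) (simp add: algebra_simps add_divide_distrib)
  qed
  finally show ?thesis .
qed

text \<open>
  Translation by 1 reindexes every row and translation by \<tau> permutes the rows, so the prescribed
  order of summation is respected.
\<close>

lemma eisenstein_at_shift:
  "eisenstein_at s (z + 1) \<tau> = eisenstein_at s z \<tau>" "eisenstein_at s (z + \<tau>) \<tau> = eisenstein_at s z \<tau>"
proof -
  have "(\<Sum>\<^sub>\<infinity>m::int. 1 / (of_int m + of_int n * \<tau> + (z + 1)) ^ s) =
        (\<Sum>\<^sub>\<infinity>m::int. 1 / (of_int m + of_int n * \<tau> + z) ^ s)" for n :: int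
    by (rule infsum_reindex_bij_witness[of _ "\<lambda>m. m - 1" "\<lambda>m. m + 1"]) (auto simp: add_ac)
  thus "eisenstein_at s (z + 1) \<tau> = eisenstein_at s z \<tau>" by (simp add: eisenstein_at_def)
  show "eisenstein_at s (z + \<tau>) \<tau> = eisenstein_at s z \<tau>"
    unfolding eisenstein_at_def
    by (rule infsum_reindex_bij_witness[of _ "\<lambda>n. n - 1" "\<lambda>n. n + 1"]) (auto simp: algebra_simps)
qed

end

section \<open>The logarithmic derivative of theta\<close>

lemma periodic_imp_lattice_periodic:
  assumes per: "\<And>z. f (z + 1) = f z" "\<And>z. f (z + \<tau>) = f z" and "w \<in> period_lattice \<tau>"
  shows "f (z + w) = f z"
proof -
  have 1: "f (z + of_int n) = f z" for z n
  proof (induction n rule: int_induct[where k = 0])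
    case (step1 i)
    thus ?case using per(1)[of "z + of_int i"] by (simp add: add.assoc)
  next
    case (step2 i)
    thus ?case using per(1)[of "z + of_int (i - 1)"] by (simp add: add.assoc)
  qed simp
  have 2: "f (z + of_int n * \<tau>) = f z" for z n
  proof (induction n rule: int_induct[where k = 0])
    case (step1 i)
    thus ?case using per(2)[of "z + of_int i * \<tau>"] by (simp add: algebra_simps)
  next
    case (step2 i)
    thus ?case using per(2)[of "z + of_int (i - 1) * \<tau>"] by (simp add: algebra_simps)
  qed simp
  obtain m n where "w = of_int m + of_int n * \<tau>" using assms(3) by (auto simp: period_lattice_def)
  hence "f (z + w) = f ((z + of_int m) + of_int n * \<tau>)" by (simp add: add.assoc)
  also have "\<dots> = f z" by (simp only: 1 2)
  finally show ?thesis .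
qed

text \<open>
  The line halfway between row 0 and row 1 is the path of integration below.
\<close>

lemma Im_half_notin_period_lattice:
  assumes "Im \<tau> > 0" "Im z = Im \<tau> / 2"
  shows "z \<notin> period_lattice \<tau>"
proof
  assume "z \<in> period_lattice \<tau>"
  then obtain m n where z: "z = of_int m + of_int n * \<tau>" by (auto simp: period_lattice_def)
  have "of_int n * Im \<tau> = Im z" by (simp add: z)
  hence "(2 * real_of_int n - 1) * Im \<tau> = 0" using assms(2) by (simp add: algebra_simps)
  hence "real_of_int (2 * n) = real_of_int 1" using assms(1) by simp
  hence "2 * n = 1" by (simp only: of_int_eq_iff)
  thus False by presburger
qed

lemma Im_horizontal_segment:
  assumes "z \<in> path_image (linepath p (p + 1))"
  shows "Im z = Im p"
proof -
  obtain u where "z = (1 - u) *\<^sub>R p + u *\<^sub>R (p + 1)"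
    using assms by (auto simp: path_image_linepath in_segment)
  hence "Im z = (1 - u) * Im p + u * Im p" by simp
  thus ?thesis by (simp add: algebra_simps)
qed

text \<open>
  All values are attained on a compact period parallelogram, so Liouville's theorem applies.
\<close>

lemma entire_doubly_periodic_constant:
  assumes hol: "f holomorphic_on UNIV" and \<tau>: "Im \<tau> > 0"
    and per: "\<And>z. f (z + 1) = f z" "\<And>z. f (z + \<tau>) = f z"
  shows "f constant_on UNIV"
proof (rule Liouville_theorem[OF hol])
  have lattice: "f (z + w) = f z" if "w \<in> period_lattice \<tau>" for z w
    using periodic_imp_lattice_periodic[OF per that] .
  let ?p = "\<lambda>(a, b). of_real a + of_real b * \<tau> :: complex"
  let ?K = "?p ` ({0..1::real} \<times> {0..1::real})"
  have "compact ?K"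
    by (intro compact_continuous_image compact_Times)
       (auto intro!: continuous_intros simp: case_prod_unfold)
  moreover have "continuous_on ?K f"
    using hol holomorphic_on_imp_continuous_on continuous_on_subset by blast
  ultimately have "bounded (f ` ?K)" using compact_continuous_image compact_imp_bounded by blast
  moreover have "range f \<subseteq> f ` ?K"
  proof (rule image_subsetI)
    fix z
    define b where "b = Im z / Im \<tau>"
    define a where "a = Re z - b * Re \<tau>"
    have "z = of_real a + of_real b * \<tau>"
      using \<tau> by (simp add: complex_eq_iff a_def b_def)
    hence "z = ?p (frac a, frac b) + (of_int \<lfloor>a\<rfloor> + of_int \<lfloor>b\<rfloor> * \<tau>)"
      by (simp add: frac_def algebra_simps)
    hence "f z = f (?p (frac a, frac b) + (of_int \<lfloor>a\<rfloor> + of_int \<lfloor>b\<rfloor> * \<tau>))" by (rule arg_cong)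
    also have "\<dots> = f (?p (frac a, frac b))" by (rule lattice[OF period_latticeI])
    finally have "f z = f (?p (frac a, frac b))" .
    moreover have "(frac a, frac b) \<in> {0..1} \<times> {0..1}"
      using frac_lt_1[of a] frac_lt_1[of b] by auto
    ultimately show "f z \<in> f ` ?K" by (simp only: image_eqI[OF refl imageI])
  qed
  ultimately show "bounded (range f)" by (rule bounded_subset)
qed

text \<open>
  The theta function at a fixed \<tau>, as a function of its first variable alone.
\<close>

locale normalised_theta =
  fixes t :: "complex \<Rightarrow> complex" and \<tau> :: complex
  assumes \<tau>: "Im \<tau> > 0"
    and t_holomorphic: "t holomorphic_on UNIV"
    and t_shift_1: "t (z + 1) = - t z"
    and t_minus: "t (- z) = - t z"
    and t_shift_\<tau>: "t (z + \<tau>) = - exp (- (of_real pi * \<i> * \<tau>)) * exp (- (2 * of_real pi * \<i> * z)) * t z"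
    and deriv_t_0: "deriv t 0 = 1"
    and t_zeros: "t z = 0 \<longleftrightarrow> z \<in> period_lattice \<tau>"
begin

definition log_deriv_t :: "complex \<Rightarrow> complex" where "log_deriv_t z = deriv t z / t z"

text \<open>
  Dividing theta by its simple zero at the origin moves the pole of the logarithmic derivative there
  out of the way. The value at 0 is the derivative of theta at 0.
\<close>

definition reduced_t :: "complex \<Rightarrow> complex" where "reduced_t z = (if z = 0 then 1 else t z / z)"

definition log_deriv_reduced :: "complex \<Rightarrow> complex" where "log_deriv_reduced z = deriv reduced_t z / reduced_t z"

lemma DERIV_t: "(t has_field_derivative deriv t z) (at z)"
  using holomorphic_derivI[OF t_holomorphic] by auto

lemma t_0: "t 0 = 0" using t_minus[of 0] by simp

lemma reduced_t_mult: "t z = z * reduced_t z" by (simp add: reduced_t_def t_0)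

lemma reduced_t_holomorphic: "reduced_t holomorphic_on UNIV"
  by (rule pole_theorem_open_0[of t _ 0]) (use t_holomorphic t_0 deriv_t_0 in \<open>auto simp: reduced_t_def\<close>)

lemma reduced_t_0: "reduced_t 0 = 1" by (simp add: reduced_t_def)

lemma reduced_t_nonzero: "z \<in> off_nonzero_lattice \<tau> \<Longrightarrow> reduced_t z \<noteq> 0"
  using t_zeros[of z] by (auto simp: reduced_t_def off_nonzero_lattice_def)

lemma reduced_t_minus: "reduced_t (- z) = reduced_t z" by (simp add: reduced_t_def t_minus)

lemma DERIV_reduced_t: "(reduced_t has_field_derivative deriv reduced_t z) (at z)"
  using holomorphic_derivI[OF reduced_t_holomorphic] by auto

lemma log_deriv_reduced_holomorphic: "log_deriv_reduced holomorphic_on off_nonzero_lattice \<tau>"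
  unfolding log_deriv_reduced_def
  by (intro holomorphic_on_divide holomorphic_deriv holomorphic_on_subset[OF reduced_t_holomorphic]
        open_off_nonzero_lattice \<tau> reduced_t_nonzero) auto

text \<open>
  A quotient of two odd functions is even, so its derivative vanishes at 0. This is why the
  coefficient of x in the exponent has no contribution from theta at the origin.
\<close>

lemma log_deriv_reduced_0: "log_deriv_reduced 0 = 0"
proof -
  have "((\<lambda>z. reduced_t (- z)) has_field_derivative deriv reduced_t 0 * (- 1)) (at 0)"
    by (rule DERIV_chain2) (use DERIV_reduced_t[of 0] in \<open>auto intro!: derivative_eq_intros\<close>)
  hence "deriv reduced_t 0 * (- 1) = deriv reduced_t 0" unfolding reduced_t_minus using DERIV_reduced_t by (rule DERIV_unique)
  hence "deriv reduced_t 0 = 0" by simp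
  thus ?thesis by (simp add: log_deriv_reduced_def)
qed

lemma open_Compl_lattice: "open (- period_lattice \<tau>)"
  using closed_subset_period_lattice[OF \<tau> order.refl] by (rule open_Compl)

lemma log_deriv_t_holomorphic: "log_deriv_t holomorphic_on - period_lattice \<tau>"
  unfolding log_deriv_t_def
  by (intro holomorphic_on_divide holomorphic_deriv holomorphic_on_subset[OF t_holomorphic]
        open_Compl_lattice) (auto simp: t_zeros)

lemma log_deriv_t_eq: "z \<notin> period_lattice \<tau> \<Longrightarrow> log_deriv_t z = 1 / z + log_deriv_reduced z"
proof -
  assume z: "z \<notin> period_lattice \<tau>"
  have "z \<noteq> 0" using z zero_in_period_lattice by auto
  have eq: "t = (\<lambda>z. z * reduced_t z)" using reduced_t_mult by blast
  have "((\<lambda>z. z * reduced_t z) has_field_derivative reduced_t z + z * deriv reduced_t z) (at z)"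
    using DERIV_reduced_t[of z] by (auto intro!: derivative_eq_intros)
  hence "(t has_field_derivative reduced_t z + z * deriv reduced_t z) (at z)" unfolding eq[symmetric] .
  hence "deriv t z = reduced_t z + z * deriv reduced_t z" by (rule DERIV_imp_deriv)
  moreover have "reduced_t z \<noteq> 0" using z by (intro reduced_t_nonzero) (auto simp: off_nonzero_lattice_def)
  ultimately show ?thesis using \<open>z \<noteq> 0\<close> by (simp add: log_deriv_t_def log_deriv_reduced_def reduced_t_mult field_simps)
qed

lemma log_deriv_t_shift_1: "log_deriv_t (z + 1) = log_deriv_t z"
proof -
  have "((\<lambda>z. t (z + 1)) has_field_derivative deriv t (z + 1)) (at z)"
    using DERIV_t DERIV_shift by blast
  hence "deriv t (z + 1) = - deriv t z"
    unfolding t_shift_1 using DERIV_minus[OF DERIV_t] by (rule DERIV_unique)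
  thus ?thesis by (simp add: log_deriv_t_def t_shift_1)
qed

text \<open>
  The logarithmic derivative is periodic only up to this constant; its derivative is elliptic.
\<close>

lemma log_deriv_t_shift_\<tau>: "z \<notin> period_lattice \<tau> \<Longrightarrow> log_deriv_t (z + \<tau>) = log_deriv_t z - 2 * of_real pi * \<i>"
proof -
  assume z: "z \<notin> period_lattice \<tau>"
  define c where "c = (\<lambda>z. - exp (- (of_real pi * \<i> * \<tau>)) * exp (- (2 * of_real pi * \<i> * z)))"
  have c: "c z \<noteq> 0" by (simp add: c_def)
  have "(c has_field_derivative - (2 * of_real pi * \<i>) * c z) (at z)"
    unfolding c_def by (auto intro!: derivative_eq_intros)
  hence deriv_ct: "((\<lambda>z. c z * t z) has_field_derivative - (2 * of_real pi * \<i>) * c z * t z + c z * deriv t z) (at z)"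
    using DERIV_t[of z] by (auto intro!: derivative_eq_intros)
  have eq: "t (z + \<tau>) = c z * t z" for z by (simp add: t_shift_\<tau> c_def)
  have "((\<lambda>z. t (z + \<tau>)) has_field_derivative deriv t (z + \<tau>)) (at z)"
    using DERIV_t DERIV_shift by blast
  hence "deriv t (z + \<tau>) = - (2 * of_real pi * \<i>) * c z * t z + c z * deriv t z"
    unfolding eq using deriv_ct by (rule DERIV_unique)
  hence "log_deriv_t (z + \<tau>) = (- (2 * of_real pi * \<i>) * c z * t z + c z * deriv t z) / (c z * t z)"
    by (simp only: log_deriv_t_def eq)
  also have "\<dots> = deriv t z / t z - 2 * of_real pi * \<i>"
    using z c t_zeros[of z] by (simp add: field_simps)
  finally show ?thesis by (simp only: log_deriv_t_def)
qed

text \<open>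
  By how much the derivative of the logarithmic derivative of theta differs from minus the
  Eisenstein sum of weight 2, written so that the double poles at the origin have cancelled.
\<close>

definition defect :: "complex \<Rightarrow> complex" where
  "defect z = deriv log_deriv_reduced z + punctured_eisenstein 2 \<tau> z"

lemma defect_holomorphic: "defect holomorphic_on off_nonzero_lattice \<tau>"
  unfolding defect_def
  by (intro holomorphic_on_add holomorphic_deriv log_deriv_reduced_holomorphic open_off_nonzero_lattice \<tau>
        punctured_eisenstein_holomorphic_on)

lemma deriv_log_deriv_t:
  assumes "z \<notin> period_lattice \<tau>"
  shows "deriv log_deriv_t z = defect z - eisenstein_at 2 z \<tau>"
proof -
  have z: "z \<in> off_nonzero_lattice \<tau>" "z \<noteq> 0"
    using assms zero_in_period_lattice[of \<tau>] by (auto simp: off_nonzero_lattice_def)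
  have "\<forall>\<^sub>F x in nhds z. x \<in> - period_lattice \<tau>"
    using assms open_Compl_lattice by (intro eventually_nhds_in_open) auto
  hence "\<forall>\<^sub>F x in nhds z. log_deriv_t x = 1 / x + log_deriv_reduced x"
    by eventually_elim (simp add: log_deriv_t_eq)
  hence "deriv log_deriv_t z = deriv (\<lambda>x. 1 / x + log_deriv_reduced x) z" by (rule deriv_cong_ev) auto
  also have "\<dots> = - 1 / z^2 + deriv log_deriv_reduced z"
  proof (rule DERIV_imp_deriv)
    have "(log_deriv_reduced has_field_derivative deriv log_deriv_reduced z) (at z)"
      using holomorphic_derivI[OF log_deriv_reduced_holomorphic open_off_nonzero_lattice[OF \<tau>] z(1)] .
    thus "((\<lambda>x. 1 / x + log_deriv_reduced x) has_field_derivative - 1 / z^2 + deriv log_deriv_reduced z) (at z)"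
      using z(2) by (auto intro!: derivative_eq_intros simp: power2_eq_square)
  qed
  finally show ?thesis
    using eisenstein_at_eq_punctured[OF \<tau> assms, of 0] by (simp add: defect_def numeral_2_eq_2)
qed

lemma defect_shift:
  assumes "z \<notin> period_lattice \<tau>"
  shows "defect (z + 1) = defect z" "defect (z + \<tau>) = defect z"
proof -
  have *: "z + 1 \<notin> period_lattice \<tau>" "z + \<tau> \<notin> period_lattice \<tau>"
    using assms by (simp_all add: add_in_period_lattice_iff periods_in_period_lattice)
  have DERIV_log_deriv_t: "(log_deriv_t has_field_derivative deriv log_deriv_t z) (at z)" if "z \<notin> period_lattice \<tau>" for z
    using that by (intro holomorphic_derivI[OF log_deriv_t_holomorphic open_Compl_lattice]) auto
  have "((\<lambda>z. log_deriv_t (z + 1)) has_field_derivative deriv log_deriv_t (z + 1)) (at z)"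
    using DERIV_log_deriv_t[OF *(1)] DERIV_shift by blast
  hence "deriv log_deriv_t (z + 1) = deriv log_deriv_t z"
    unfolding log_deriv_t_shift_1 using DERIV_log_deriv_t[OF assms] by (rule DERIV_unique)
  thus "defect (z + 1) = defect z"
    using deriv_log_deriv_t[OF assms] deriv_log_deriv_t[OF *(1)] eisenstein_at_shift[OF \<tau>] by simp
  have "\<forall>\<^sub>F x in nhds z. x \<in> - period_lattice \<tau>"
    using assms open_Compl_lattice by (intro eventually_nhds_in_open) auto
  hence ev: "\<forall>\<^sub>F x in nhds z. log_deriv_t (x + \<tau>) = log_deriv_t x - 2 * of_real pi * \<i>"
    by eventually_elim (simp add: log_deriv_t_shift_\<tau>)
  have "((\<lambda>z. log_deriv_t (z + \<tau>)) has_field_derivative deriv log_deriv_t (z + \<tau>)) (at z)"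
    using DERIV_log_deriv_t[OF *(2)] DERIV_shift by blast
  hence "((\<lambda>z. log_deriv_t z - 2 * of_real pi * \<i>) has_field_derivative deriv log_deriv_t (z + \<tau>)) (at z)"
    using DERIV_cong_ev[OF refl ev refl] by blast
  moreover have "((\<lambda>z. log_deriv_t z - 2 * of_real pi * \<i>) has_field_derivative deriv log_deriv_t z - 0) (at z)"
    by (intro DERIV_diff DERIV_log_deriv_t assms DERIV_const)
  ultimately have "deriv log_deriv_t (z + \<tau>) = deriv log_deriv_t z - 0" by (rule DERIV_unique)
  thus "defect (z + \<tau>) = defect z"
    using deriv_log_deriv_t[OF assms] deriv_log_deriv_t[OF *(2)] eisenstein_at_shift[OF \<tau>] by simp
qed

text \<open>
  The defect is elliptic, and it is regular at the origin, hence by periodicity at every lattice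
  point, so it extends to an entire doubly periodic function.
\<close>

lemma defect_constant:
  assumes z: "z \<in> off_nonzero_lattice \<tau>"
  shows "defect z = defect 0"
proof -
  \<comment> \<open>the defect continued to the other lattice points by its value at the origin\<close>
  define H where "H = (\<lambda>z. if z \<in> period_lattice \<tau> then defect 0 else defect z)"
  have per: "H (z + 1) = H z" "H (z + \<tau>) = H z" for z
    by (simp_all add: H_def defect_shift add_in_period_lattice_iff periods_in_period_lattice)
  have on_off: "H z = defect z" if "z \<in> off_nonzero_lattice \<tau>" for z
    using that by (auto simp: H_def off_nonzero_lattice_def)
  have hol: "H holomorphic_on off_nonzero_lattice \<tau>"
    using defect_holomorphic by (rule holomorphic_transform) (simp add: on_off)
  have lattice: "H (z + w) = H z" if "w \<in> period_lattice \<tau>" for z w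
    using per that by (rule periodic_imp_lattice_periodic)
  have "H field_differentiable at z" for z
  proof (cases "z \<in> period_lattice \<tau>")
    case False
    thus ?thesis
      using hol open_off_nonzero_lattice[OF \<tau>] by (auto simp: holomorphic_on_open off_nonzero_lattice_def field_differentiable_def)
  next
    case True
    have "0 \<in> off_nonzero_lattice \<tau>" by (simp add: off_nonzero_lattice_def)
    then obtain d where d: "(H has_field_derivative d) (at 0)"
      using hol open_off_nonzero_lattice[OF \<tau>] by (auto simp: holomorphic_on_open)
    have "((\<lambda>x. H (x - z)) has_field_derivative d * 1) (at z)"
      by (rule DERIV_chain2) (auto intro!: derivative_eq_intros d)
    moreover have "H (x - z) = H x" for x using lattice[OF True, of "x - z"] by simp
    ultimately show ?thesis by (auto simp: field_differentiable_def)
  qed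
  hence "H holomorphic_on UNIV" by (simp add: holomorphic_on_def field_differentiable_at_within)
  hence "H constant_on UNIV" by (rule entire_doubly_periodic_constant[OF _ \<tau> per])
  hence "H z = H 0" by (auto simp: constant_on_def)
  thus ?thesis using z on_off[of z] on_off[of 0] by (simp add: off_nonzero_lattice_def)
qed

text \<open>
  A full row has the primitive - \<pi> cot (\<pi> (n \<tau> + z)), which has period 1. In row 0 the
  absent term 1 / z^2 adds 1 / z to the primitive, and only this leaves a contribution.
\<close>

lemma contour_integral_eisenstein_row:
  fixes n :: int
  defines "p \<equiv> \<tau> / 2"
  shows "((\<lambda>z. \<Sum>\<^sub>\<infinity>m\<in>{m::int. n = 0 \<longrightarrow> m \<noteq> 0}. 1 / (of_int m + (of_int n * \<tau> + z)) ^ 2)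
            has_contour_integral (if n = 0 then 1 / (p + 1) - 1 / p else 0)) (linepath p (p + 1))"
proof -
  let ?S = "path_image (linepath p (p + 1))"
  define P where "P = (\<lambda>z. - of_real pi * cot (of_real pi * (of_int n * \<tau> + z)) + (if n = 0 then 1 / z else 0))"
  have S: "Im z = Im \<tau> / 2" if "z \<in> ?S" for z
    using Im_horizontal_segment[of z p] that by (simp add: p_def)
  have "(P has_field_derivative
      (\<Sum>\<^sub>\<infinity>m\<in>{m. n = 0 \<longrightarrow> m \<noteq> 0}. 1 / (of_int m + (of_int n * \<tau> + z)) ^ 2)) (at z within ?S)"
    if z: "z \<in> ?S" for z
  proof -
    have zL: "z \<notin> period_lattice \<tau>"
      using \<tau> S[OF z] by (rule Im_half_notin_period_lattice)
    have w: "of_int n * \<tau> + z \<notin> \<int>"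
    proof
      assume "of_int n * \<tau> + z \<in> \<int>"
      then obtain k where "of_int n * \<tau> + z = of_int k" by (auto elim!: Ints_cases)
      hence "of_int (- k) + (of_int n * \<tau> + z) = 0" by simp
      thus False using zL lattice_shift_eq_0D by blast
    qed
    hence nz: "sin (of_real pi * (of_int n * \<tau> + z)) \<noteq> 0" by (auto simp: sin_eq_0 mult.commute)
    have "z \<noteq> 0" using zL zero_in_period_lattice by auto
    have "(P has_field_derivative (of_real pi / sin (of_real pi * (of_int n * \<tau> + z)))^2 -
             (if n = 0 then 1 / z ^ 2 else 0)) (at z)"
    proof -
      let ?w = "of_real pi * (of_int n * \<tau> + z)"
      have "((\<lambda>z. of_real pi * (of_int n * \<tau> + z)) has_field_derivative of_real pi) (at z)"
        by (auto intro!: derivative_eq_intros)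
      from DERIV_cmult[OF DERIV_chain2[OF DERIV_cot[OF nz] this], of "- of_real pi"]
      have "((\<lambda>z. - of_real pi * cot (of_real pi * (of_int n * \<tau> + z))) has_field_derivative
              (of_real pi / sin ?w)^2) (at z)"
        by (simp add: power2_eq_square divide_inverse mult_ac)
      moreover have "((\<lambda>z. if n = 0 then 1 / z else 0) has_field_derivative (if n = 0 then - 1 / z ^ 2 else 0)) (at z)"
        using \<open>z \<noteq> 0\<close> by (auto intro!: derivative_eq_intros simp: power2_eq_square)
      ultimately have "(P has_field_derivative (of_real pi / sin ?w)^2 + (if n = 0 then - 1 / z ^ 2 else 0)) (at z)"
        unfolding P_def by (rule DERIV_add)
      also have "(of_real pi / sin ?w)^2 + (if n = 0 then - 1 / z ^ 2 else 0) =
          (of_real pi / sin ?w)^2 - (if n = 0 then 1 / z ^ 2 else 0)" by simp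
      finally show ?thesis .
    qed
    moreover have "(of_real pi / sin (of_real pi * (of_int n * \<tau> + z)))^2 - (if n = 0 then 1 / z ^ 2 else 0) =
      (\<Sum>\<^sub>\<infinity>m\<in>{m. n = 0 \<longrightarrow> m \<noteq> 0}. 1 / (of_int m + (of_int n * \<tau> + z)) ^ 2)"
      using eisenstein_row_split[OF \<tau> zL, of n 0, unfolded add_0] infsumI[OF has_sum_inverse_square_complex[OF w]]
      by (simp only: diff_eq_eq)
    ultimately show ?thesis by (simp only: has_field_derivative_at_within)
  qed
  from contour_integral_primitive[OF this _ order.refl]
  have "((\<lambda>z. \<Sum>\<^sub>\<infinity>m\<in>{m. n = 0 \<longrightarrow> m \<noteq> 0}. 1 / (of_int m + (of_int n * \<tau> + z)) ^ 2)
            has_contour_integral (P (p + 1) - P p)) (linepath p (p + 1))" by simp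
  also have "P (p + 1) - P p = (if n = 0 then 1 / (p + 1) - 1 / p else 0)"
  proof -
    have "cot (of_real pi * (of_int n * \<tau> + (p + 1))) = cot (of_real pi * (of_int n * \<tau> + p) + of_real pi)"
      by (simp add: algebra_simps)
    also have "\<dots> = cot (of_real pi * (of_int n * \<tau> + p))"
      by (simp add: cot_def sin_add cos_add sin_of_real cos_of_real)
    finally show ?thesis by (simp add: P_def)
  qed
  finally show ?thesis .
qed

text \<open>
  The constant is found by integrating over a segment of length 1 parallel to the real axis: the
  logarithmic derivative of theta has period 1, and so have the primitives of all the full rows.
  Uniform convergence on the segment allows integration row by row, which is where the order of
  summation in weight 2 enters.
\<close>

lemma defect_eq_0:
  assumes "z \<in> off_nonzero_lattice \<tau>"
  shows "defect z = 0"
proof -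
  define p where "p = \<tau> / 2"
  let ?\<gamma> = "linepath p (p + 1)"
  let ?E = "punctured_eisenstein 2 \<tau>"
  have S: "path_image ?\<gamma> \<subseteq> - period_lattice \<tau>"
  proof
    fix z assume "z \<in> path_image ?\<gamma>"
    hence "Im z = Im \<tau> / 2" using Im_horizontal_segment[of z p] by (simp add: p_def)
    thus "z \<in> - period_lattice \<tau>" using Im_half_notin_period_lattice[OF \<tau>] by simp
  qed
  have sub: "path_image ?\<gamma> \<subseteq> off_nonzero_lattice \<tau>" using S by (auto simp: off_nonzero_lattice_def)
  note unif = uniform_limit_punctured_eisenstein[OF \<tau> compact_path_image sub]
  have rows: "((\<lambda>z. \<Sum>n\<in>A. \<Sum>\<^sub>\<infinity>m\<in>{m::int. n = 0 \<longrightarrow> m \<noteq> 0}. 1 / (of_int m + (of_int n * \<tau> + z)) ^ 2)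
            has_contour_integral (\<Sum>n\<in>A. if n = 0 then 1 / (p + 1) - 1 / p else 0)) ?\<gamma>"
    if "finite A" for A :: "int set"
    using that unfolding p_def by (intro has_contour_integral_sum contour_integral_eisenstein_row)
  have "?E contour_integrable_on ?\<gamma>" and
    lim: "((\<lambda>A. contour_integral ?\<gamma> (\<lambda>z. \<Sum>n\<in>A. \<Sum>\<^sub>\<infinity>m\<in>{m::int. n = 0 \<longrightarrow> m \<noteq> 0}.
        1 / (of_int m + (of_int n * \<tau> + z)) ^ 2)) \<longlongrightarrow> contour_integral ?\<gamma> ?E) (finite_subsets_at_top UNIV)"
  proof -
    have ev: "\<forall>\<^sub>F A in finite_subsets_at_top UNIV. (\<lambda>z. \<Sum>n\<in>A. \<Sum>\<^sub>\<infinity>m\<in>{m::int. n = 0 \<longrightarrow> m \<noteq> 0}.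
        1 / (of_int m + (of_int n * \<tau> + z)) ^ 2) contour_integrable_on ?\<gamma>"
      by (rule eventually_finite_subsets_at_top_weakI)
         (auto intro: has_contour_integral_integrable[OF rows])
    \<comment> \<open>the segment has unit speed\<close>
  have der: "norm (vector_derivative ?\<gamma> (at u)) \<le> 1" for u by simp
    show "?E contour_integrable_on ?\<gamma>"
      by (rule contour_integral_uniform_limit(1)[OF ev unif der]) auto
    show "((\<lambda>A. contour_integral ?\<gamma> (\<lambda>z. \<Sum>n\<in>A. \<Sum>\<^sub>\<infinity>m\<in>{m::int. n = 0 \<longrightarrow> m \<noteq> 0}.
        1 / (of_int m + (of_int n * \<tau> + z)) ^ 2)) \<longlongrightarrow> contour_integral ?\<gamma> ?E) (finite_subsets_at_top UNIV)"
      by (rule contour_integral_uniform_limit(2)[OF ev unif der]) auto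
  qed
  have ev: "\<forall>\<^sub>F A in finite_subsets_at_top UNIV. contour_integral ?\<gamma> (\<lambda>z. \<Sum>n\<in>A. \<Sum>\<^sub>\<infinity>m\<in>{m::int. n = 0 \<longrightarrow> m \<noteq> 0}.
        1 / (of_int m + (of_int n * \<tau> + z)) ^ 2) = 1 / (p + 1) - 1 / p"
    unfolding eventually_finite_subsets_at_top
  proof (intro exI[of _ "{0}"] conjI allI impI)
    fix A :: "int set" assume "finite A \<and> {0} \<subseteq> A \<and> A \<subseteq> UNIV"
    thus "contour_integral ?\<gamma> (\<lambda>z. \<Sum>n\<in>A. \<Sum>\<^sub>\<infinity>m\<in>{m::int. n = 0 \<longrightarrow> m \<noteq> 0}.
        1 / (of_int m + (of_int n * \<tau> + z)) ^ 2) = 1 / (p + 1) - 1 / p"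
      using contour_integral_unique[OF rows[of A]] by simp
  qed auto
  have "contour_integral ?\<gamma> ?E = 1 / (p + 1) - 1 / p"
    by (rule tendsto_unique[OF finite_subsets_at_top_neq_bot lim tendsto_eventually[OF ev]])
  hence E: "(?E has_contour_integral 1 / (p + 1) - 1 / p) ?\<gamma>"
    using has_contour_integral_integral[OF \<open>?E contour_integrable_on ?\<gamma>\<close>] by simp
  have "(deriv log_deriv_reduced has_contour_integral log_deriv_reduced (pathfinish ?\<gamma>) - log_deriv_reduced (pathstart ?\<gamma>)) ?\<gamma>"
  proof (rule contour_integral_primitive)
    show "(log_deriv_reduced has_field_derivative deriv log_deriv_reduced z) (at z within off_nonzero_lattice \<tau>)" if "z \<in> off_nonzero_lattice \<tau>" for z
      using holomorphic_derivI[OF log_deriv_reduced_holomorphic open_off_nonzero_lattice[OF \<tau>] that]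
      by (rule has_field_derivative_at_within)
  qed (use sub in auto)
  from has_contour_integral_add[OF this E]
  have "(defect has_contour_integral log_deriv_reduced (p + 1) - log_deriv_reduced p + (1 / (p + 1) - 1 / p)) ?\<gamma>"
    by (simp add: defect_def[abs_def])
  \<comment> \<open>periodicity of the full logarithmic derivative, whose polar part is 1 / z\<close>
  moreover have "log_deriv_reduced (p + 1) - log_deriv_reduced p + (1 / (p + 1) - 1 / p) = 0"
  proof -
    have "p \<in> - period_lattice \<tau>" "p + 1 \<in> - period_lattice \<tau>"
      using S pathstart_in_path_image[of ?\<gamma>] pathfinish_in_path_image[of ?\<gamma>] by auto
    thus ?thesis using log_deriv_t_eq[of p] log_deriv_t_eq[of "p + 1"] log_deriv_t_shift_1[of p] by (simp add: algebra_simps)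
  qed
  ultimately have "(defect has_contour_integral 0) ?\<gamma>" by simp
  hence "((\<lambda>_. defect 0) has_contour_integral 0) ?\<gamma>"
    by (rule has_contour_integral_eq) (use sub defect_constant in auto)
  moreover have "((\<lambda>_. defect 0) has_contour_integral defect 0 * ((p + 1) - p)) ?\<gamma>"
    using has_contour_integral_const_linepath by blast
  ultimately have "defect 0 = 0" using contour_integral_unique by force
  thus ?thesis using defect_constant[OF assms] by simp
qed

end

section \<open>The Laurent expansion\<close>

text \<open>
  The formal version of the fact that K' = a' K with K(0) = 1 determines K = exp a: multiplying K by
  exp (- a) gives a series with vanishing derivative.
\<close>

lemma fps_eq_exp_compose:
  fixes k a :: "'a :: field_char_0 fps"
  assumes "fps_deriv k = k * fps_deriv a" "fps_nth k 0 = 1" "fps_nth a 0 = 0"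
  shows "k = fps_exp 1 oo a"
proof -
  let ?e = "fps_exp 1 oo a" and ?e' = "fps_exp (- 1) oo a"
  have "?e * ?e' = (fps_exp 1 * fps_exp (- 1)) oo a"
    using assms(3) by (simp add: fps_compose_mult_distrib)
  also have "fps_exp 1 * fps_exp (- 1) = (1 :: 'a fps)"
    using fps_exp_add_mult[of 1 "- 1 :: 'a"] by simp
  finally have inv: "?e * ?e' = 1" by simp
  have "fps_deriv ?e' = - ?e' * fps_deriv a"
    using assms(3) by (simp add: fps_compose_deriv fps_compose_mult_distrib fps_compose_uminus flip: fps_const_neg)
  hence "fps_deriv (k * ?e') = 0"
    using assms(1) by (simp add: algebra_simps)
  hence "k * ?e' = fps_const (fps_nth (k * ?e') 0)" by (simp only: fps_deriv_eq_0_iff)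
  also have "\<dots> = 1" using assms(2) by simp
  finally have "k * ?e' * ?e = ?e" by simp
  thus ?thesis using inv by (simp add: mult.assoc mult.commute[of ?e'])
qed

context normalised_theta
begin

lemma deriv_log_deriv_t_eq:
  assumes "z \<notin> period_lattice \<tau>"
  shows "deriv log_deriv_t z = - eisenstein_at 2 z \<tau>"
  using deriv_log_deriv_t[OF assms] defect_eq_0[of z] assms by (simp add: off_nonzero_lattice_def)

lemma deriv_log_deriv_reduced_eq: "z \<in> off_nonzero_lattice \<tau> \<Longrightarrow> deriv log_deriv_reduced z = - punctured_eisenstein 2 \<tau> z"
  using defect_eq_0[of z] by (simp add: defect_def add_eq_0_iff)

lemma higher_deriv_log_deriv_reduced_0:
  "(deriv ^^ Suc j) log_deriv_reduced 0 = - ((- 1) ^ j * fact (Suc j) * eisenstein (j + 2) \<tau>)"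
proof -
  have 0: "0 \<in> off_nonzero_lattice \<tau>" by (simp add: off_nonzero_lattice_def)
  have ev: "\<forall>\<^sub>F x in nhds 0. x \<in> off_nonzero_lattice \<tau>"
    using 0 open_off_nonzero_lattice[OF \<tau>] by (intro eventually_nhds_in_open)
  have "(deriv ^^ Suc j) log_deriv_reduced 0 = (deriv ^^ j) (deriv log_deriv_reduced) 0" by (simp only: funpow_Suc_right o_apply)
  also have "\<dots> = (deriv ^^ j) (\<lambda>z. - punctured_eisenstein 2 \<tau> z) 0"
    by (rule higher_deriv_cong_ev[OF eventually_mono[OF ev] refl]) (rule deriv_log_deriv_reduced_eq)
  also have "\<dots> = - (deriv ^^ j) (punctured_eisenstein 2 \<tau>) 0"
    by (rule higher_deriv_uminus[OF punctured_eisenstein_holomorphic_on[OF \<tau>] open_off_nonzero_lattice[OF \<tau>] 0])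
  finally show ?thesis
    by (simp only: higher_deriv_punctured_eisenstein[OF \<tau> 0] eisenstein_eq_punctured)
qed

lemma higher_deriv_log_deriv_t:
  assumes a: "a \<notin> period_lattice \<tau>"
  shows "(deriv ^^ Suc j) log_deriv_t a = - ((- 1) ^ j * fact (Suc j) * eisenstein_at (j + 2) a \<tau>)"
proof -
  have ev: "\<forall>\<^sub>F x in nhds a. x \<in> - period_lattice \<tau>"
    using a open_Compl_lattice by (intro eventually_nhds_in_open) auto
  have hol: "(\<lambda>z. eisenstein_at 2 z \<tau>) holomorphic_on - period_lattice \<tau>"
  proof (rule holomorphic_transform)
    show "(\<lambda>z. - deriv log_deriv_t z) holomorphic_on - period_lattice \<tau>"
      by (intro holomorphic_on_minus holomorphic_deriv log_deriv_t_holomorphic open_Compl_lattice)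
  qed (simp add: deriv_log_deriv_t_eq)
  have "(deriv ^^ Suc j) log_deriv_t a = (deriv ^^ j) (deriv log_deriv_t) a" by (simp only: funpow_Suc_right o_apply)
  also have "\<dots> = (deriv ^^ j) (\<lambda>z. - eisenstein_at 2 z \<tau>) a"
    by (rule higher_deriv_cong_ev[OF eventually_mono[OF ev] refl]) (simp add: deriv_log_deriv_t_eq)
  also have "\<dots> = - (deriv ^^ j) (\<lambda>z. eisenstein_at 2 z \<tau>) a"
    by (rule higher_deriv_uminus[OF hol open_Compl_lattice]) (use a in simp)
  finally show ?thesis by (simp only: higher_deriv_eisenstein_at[OF \<tau> a])
qed

text \<open>
  Removing the factor 1 / x leaves a function K with K(0) = 1 that is regular at 0, and everything is
  read off from its logarithmic derivative, whose Taylor coefficients of positive order are, up to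
  sign, differences of Eisenstein series at a and at 0.
\<close>

theorem kronecker_quotient_laurent_expansion:
  fixes a c :: complex
  assumes a: "a \<notin> period_lattice \<tau>"
  defines "A \<equiv> (\<lambda>s. if s = 0 then 0 else if s = 1 then c + deriv t a / t a
      else (- 1) ^ s * (eisenstein s \<tau> - eisenstein_at s a \<tau>) / of_nat s)"
  shows "(\<lambda>x. exp (c * x) * (t (a + x) / (t a * t x))) has_laurent_expansion
           fls_X_inv * fps_to_fls (fps_exp 1 oo Abs_fps A)"
proof -
  \<comment> \<open>x times the quotient and its logarithmic derivative, on a neighbourhood of 0 that avoids all zeros involved\<close>
  define K where "K = (\<lambda>x. exp (c * x) * (t (a + x) / (t a * reduced_t x)))"
  define l where "l = (\<lambda>x. c + log_deriv_t (a + x) - log_deriv_reduced x)"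
  define S where "S = off_nonzero_lattice \<tau> \<inter> (\<lambda>x. a + x) -` (- period_lattice \<tau>)"
  have "open S" unfolding S_def
    by (intro open_Int open_off_nonzero_lattice \<tau> open_vimage open_Compl_lattice continuous_intros)
  have "0 \<in> S" using a by (simp add: S_def off_nonzero_lattice_def)
  have ta: "t a \<noteq> 0" using a t_zeros by simp
  have shift: "(\<lambda>x. f (a + x)) holomorphic_on S" if "f holomorphic_on - period_lattice \<tau>" for f :: "complex \<Rightarrow> complex"
  proof -
    have "f \<circ> (\<lambda>x. a + x) holomorphic_on S"
      by (rule holomorphic_on_compose_gen[OF _ that]) (auto intro!: holomorphic_intros simp: S_def)
    thus ?thesis by (simp add: o_def)
  qed
  have hol_l: "l holomorphic_on S"
    unfolding l_def
    by (intro holomorphic_intros shift log_deriv_t_holomorphic holomorphic_on_subset[OF log_deriv_reduced_holomorphic]) (auto simp: S_def)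
  have hol_K: "K holomorphic_on S"
    unfolding K_def
    by (intro holomorphic_intros shift holomorphic_on_subset[OF t_holomorphic] holomorphic_on_subset[OF reduced_t_holomorphic])
       (use ta reduced_t_nonzero in \<open>auto simp: S_def\<close>)
  have deriv_K: "deriv K x = K x * l x" if x: "x \<in> S" for x
  proof (rule DERIV_imp_deriv)
    have nz: "reduced_t x \<noteq> 0" "t (a + x) \<noteq> 0" using x reduced_t_nonzero t_zeros by (auto simp: S_def)
    have dt: "((\<lambda>x. t (a + x)) has_field_derivative deriv t (a + x)) (at x)"
      using DERIV_t[of "x + a"] DERIV_shift[of t _ x a] by (simp add: add.commute)
    have de: "((\<lambda>x. exp (c * x)) has_field_derivative c * exp (c * x)) (at x)"
      by (auto intro!: derivative_eq_intros)
    have "(K has_field_derivative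
       c * exp (c * x) * (t (a + x) / (t a * reduced_t x)) +
       (deriv t (a + x) * (t a * reduced_t x) - t (a + x) * (t a * deriv reduced_t x)) / ((t a * reduced_t x) * (t a * reduced_t x)) * exp (c * x)) (at x)"
      unfolding K_def using nz ta
      by (intro DERIV_mult de DERIV_divide dt DERIV_cmult DERIV_reduced_t) auto
    also have "c * exp (c * x) * (t (a + x) / (t a * reduced_t x)) +
       (deriv t (a + x) * (t a * reduced_t x) - t (a + x) * (t a * deriv reduced_t x)) / ((t a * reduced_t x) * (t a * reduced_t x)) * exp (c * x) =
       K x * l x"
      unfolding K_def l_def log_deriv_t_def log_deriv_reduced_def using nz ta by (simp add: divide_simps) (simp add: algebra_simps)
    finally show "(K has_field_derivative K x * l x) (at x)" .
  qed
  have fps_K: "K has_fps_expansion fps_expansion K 0"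
    using \<open>open S\<close> \<open>0 \<in> S\<close> hol_K by (rule has_fps_expansion_fps_expansion)
  have fps_l: "l has_fps_expansion fps_expansion l 0"
    using \<open>open S\<close> \<open>0 \<in> S\<close> hol_l by (rule has_fps_expansion_fps_expansion)
  have "fps_expansion l 0 = fps_deriv (Abs_fps A)"
  proof (rule fps_ext)
    fix n
    show "fps_nth (fps_expansion l 0) n = fps_nth (fps_deriv (Abs_fps A)) n"
    proof (cases n)
      case 0
      thus ?thesis by (simp add: fps_expansion_def l_def log_deriv_reduced_0 A_def log_deriv_t_def)
    next
      case (Suc j)
      have "(deriv ^^ Suc j) l 0 = (deriv ^^ Suc j) (\<lambda>x. c + log_deriv_t (a + x)) 0 - (deriv ^^ Suc j) log_deriv_reduced 0"
        unfolding l_def using \<open>open S\<close> \<open>0 \<in> S\<close>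
        by (intro higher_deriv_diff[of _ S] holomorphic_intros shift log_deriv_t_holomorphic
              holomorphic_on_subset[OF log_deriv_reduced_holomorphic]) (auto simp: S_def)
      also have "(deriv ^^ Suc j) (\<lambda>x. c + log_deriv_t (a + x)) 0 =
          (deriv ^^ Suc j) (\<lambda>x. c) 0 + (deriv ^^ Suc j) (\<lambda>x. log_deriv_t (a + x)) 0"
        using \<open>open S\<close> \<open>0 \<in> S\<close>
        by (intro higher_deriv_add[of _ S] holomorphic_intros shift log_deriv_t_holomorphic)
      also have "(deriv ^^ Suc j) (\<lambda>x. log_deriv_t (a + x)) 0 = (deriv ^^ Suc j) log_deriv_t a"
        using higher_deriv_shift_0[of "Suc j" log_deriv_t a] by (simp only: o_def)
      finally have "(deriv ^^ Suc j) l 0 =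
          (- 1) ^ j * fact (Suc j) * (eisenstein (j + 2) \<tau> - eisenstein_at (j + 2) a \<tau>)"
        unfolding higher_deriv_const higher_deriv_log_deriv_t[OF a] higher_deriv_log_deriv_reduced_0 by (simp add: algebra_simps)
      hence "fps_nth (fps_expansion l 0) n = (- 1) ^ j * (eisenstein (j + 2) \<tau> - eisenstein_at (j + 2) a \<tau>)"
        by (simp add: fps_expansion_def Suc del: funpow.simps fact_Suc)
      also have "\<dots> = fps_nth (fps_deriv (Abs_fps A)) n"
        by (simp add: Suc A_def del: of_nat_Suc of_nat_add)
      finally show ?thesis .
    qed
  qed
  moreover have "fps_deriv (fps_expansion K 0) = fps_expansion K 0 * fps_expansion l 0"
  proof (rule fps_expansion_unique_complex)
    show "deriv K has_fps_expansion fps_deriv (fps_expansion K 0)"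
      using fps_K by (rule has_fps_expansion_deriv)
    have "(\<lambda>x. K x * l x) has_fps_expansion fps_expansion K 0 * fps_expansion l 0"
      using fps_K fps_l by (rule has_fps_expansion_mult)
    moreover have ev: "\<forall>\<^sub>F x in nhds 0. K x * l x = deriv K x"
      using eventually_nhds_in_open[OF \<open>open S\<close> \<open>0 \<in> S\<close>] by eventually_elim (simp add: deriv_K)
    ultimately show "deriv K has_fps_expansion fps_expansion K 0 * fps_expansion l 0"
      by (simp add: has_fps_expansion_cong[OF ev refl])
  qed
  moreover have "fps_nth (fps_expansion K 0) 0 = 1"
    using ta by (simp add: fps_expansion_def K_def reduced_t_0)
  ultimately have "fps_expansion K 0 = fps_exp 1 oo Abs_fps A"
    by (intro fps_eq_exp_compose) (simp_all add: A_def)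
  with fps_K have "K has_laurent_expansion fps_to_fls (fps_exp 1 oo Abs_fps A)"
    by (simp add: has_laurent_expansion_fps)
  hence "(\<lambda>x. inverse x * K x) has_laurent_expansion fls_X_inv * fps_to_fls (fps_exp 1 oo Abs_fps A)"
    by (intro has_laurent_expansion_mult has_laurent_expansion_fls_X_inv)
  moreover have "inverse x * K x = exp (c * x) * (t (a + x) / (t a * t x))" for x
    by (simp add: K_def reduced_t_mult[of x] divide_inverse mult_ac)
  ultimately show ?thesis by simp
qed

end

text \<open>
  Holomorphy in both variables is restricted to the slice with \<tau> fixed by the chain rule for
  z \<mapsto> (z, \<tau>).
\<close>

lemma theta_function_imp_normalised:
  assumes \<theta>: "theta_function \<theta>" and \<tau>: "Im \<tau> > 0"
  shows "normalised_theta (\<lambda>z. \<theta> z \<tau>) \<tau>"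
proof
  show "(\<lambda>z. \<theta> z \<tau>) holomorphic_on UNIV"
    unfolding holomorphic_on_open[OF open_UNIV]
  proof
    fix z :: complex
    have "(z, \<tau>) \<in> UNIV \<times> {\<tau>. Im \<tau> > 0}" using \<tau> by simp
    then obtain a b where
      "((\<lambda>(z, \<tau>). \<theta> z \<tau>) has_derivative (\<lambda>(h, k). a * h + b * k)) (at (z, \<tau>) within UNIV \<times> {\<tau>. Im \<tau> > 0})"
      using \<theta> unfolding theta_function_def holomorphic2_on_def by blast
    hence der: "((\<lambda>(z, \<tau>). \<theta> z \<tau>) has_derivative (\<lambda>(h, k). a * h + b * k)) (at (z, \<tau>) within range (\<lambda>z. (z, \<tau>)))"
      using \<tau> by (auto intro: has_derivative_subset)
    have "((\<lambda>z. (z, \<tau>)) has_derivative (\<lambda>h. (h, 0))) (at z)"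
      by (auto intro!: derivative_eq_intros)
    from has_derivative_in_compose[OF this der]
    have "((\<lambda>z. \<theta> z \<tau>) has_derivative (\<lambda>h. a * h)) (at z)" by (simp add: o_def)
    thus "\<exists>f'. ((\<lambda>z. \<theta> z \<tau>) has_field_derivative f') (at z)"
      unfolding has_field_derivative_def by blast
  qed
  have zeros: "{z. \<theta> z \<tau> = 0} = period_lattice \<tau>"
    using \<theta> \<tau> unfolding theta_function_def by blast
  show "\<theta> z \<tau> = 0 \<longleftrightarrow> z \<in> period_lattice \<tau>" for z
    unfolding zeros[symmetric] by simp
qed (use \<theta> \<tau> in \<open>simp_all add: theta_function_def\<close>)

lemma torsion_point_notin_period_lattice:
  assumes "M \<ge> 1" "N \<ge> 1" "\<not> ([u = 0] (mod M) \<and> [v = 0] (mod N))" "Im \<tau> > 0"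
  shows "torsion_point M N u v \<tau> \<notin> period_lattice \<tau>"
proof
  assume "torsion_point M N u v \<tau> \<in> period_lattice \<tau>"
  then obtain m n where eq: "torsion_point M N u v \<tau> = of_int m + of_int n * \<tau>"
    by (auto simp: period_lattice_def)
  have real: "of_int k / of_int l = complex_of_real (of_int k / of_int l)" for k l by simp
  have "of_int v / of_int N * Im \<tau> = of_int n * Im \<tau>"
    using arg_cong[OF eq, of Im] unfolding torsion_point_def real by simp
  hence "of_int v / of_int N = (of_int n :: real)"
    unfolding mult_cancel_right using assms(4) by auto
  hence "real_of_int v = real_of_int (n * N)" using assms(2) by (simp add: field_simps)
  hence v: "v = n * N" by (simp only: of_int_eq_iff)
  have "of_int u / of_int M = (of_int m :: complex)"
    using eq assms(2) by (simp add: torsion_point_def v)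
  hence "complex_of_int u = complex_of_int (m * M)" using assms(1) by (simp add: field_simps)
  hence "u = m * M" by (simp only: of_int_eq_iff)
  with v assms(3) show False by (simp add: cong_0_iff)
qed

theorem lemma7p8:
  fixes \<theta> :: "complex \<Rightarrow> complex \<Rightarrow> complex" and M N u v :: int and \<tau> :: complex
  assumes "theta_function \<theta>"
    and "M \<ge> 1" and "N \<ge> 1"
    and "\<not> ([u = 0] (mod M) \<and> [v = 0] (mod N))"
    and "Im \<tau> > 0"
  shows "(\<lambda>x. F_gamma \<theta> M N u v x \<tau>) has_laurent_expansion
           fls_X_inv * fps_to_fls (fps_exp 1 oo Abs_fps (a_gamma \<theta> M N u v \<tau>))"
proof -
  interpret normalised_theta "\<lambda>z. \<theta> z \<tau>" \<tau>
    using assms(1,5) by (rule theta_function_imp_normalised)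
  have "torsion_point M N u v \<tau> \<notin> period_lattice \<tau>"
    using assms(2-5) by (rule torsion_point_notin_period_lattice)
  from kronecker_quotient_laurent_expansion[OF this, of "2 * of_real pi * \<i> * of_int v / of_int N"]
  show ?thesis unfolding F_gamma_def a_gamma_def[abs_def] .
qed

end
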